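(* Let $\mathcal{F}$ be a germ of a singular holomorphic foliation at $(\mathbb{C}^2,0)$, and let $X$ be a germ of a reduced curve at $(\mathbb{C}^2,0)$. Assume that $X$ is not invariant by $\mathcal{F}$ (no irreducible component of $X$ is invariant by $\mathcal{F}$). Then \[\mu_{BR}(\mathcal{F},X)=\mu_0(\mathcal{F})+\operatorname{tang}(\mathcal{F},X,0)-\tau_0(X).\]
   Context: $\mathcal{O}_2$ is the ring of germs of holomorphic functions at $0\in\mathbb{C}^2$. The foliation $\mathcal{F}$ is defined by a holomorphic 1-form $\omega=A\,dx+B\,dy$, or equivalently by the dual vector field $v=-B\frac{\partial}{\partial x}+A\frac{\partial}{\partial y}$, with $A,B\in\mathcal{O}_2$ relatively prime; $\mathcal{F}$ is singular at $0$ if $A(0)=B(0)=0$. A curve $\{f=0\}$ is invariant by $\mathcal{F}$ if $f$ divides the coefficient of $dx\wedge dy$ in $\omega\wedge df$. Let $\phi$ be a reduced equation of $X$, $I_X=\langle\phi\rangle$, and $\Theta_X=\{\xi:\ \xi\text{ germ of holomorphic vector field at }0,\ d\phi(\xi)\in I_X\}$. Define $\mu_{BR}(\mathcal{F},X)=\dim_{\mathbb{C}}\mathcal{O}_2/\omega(\Theta_X)$ with $\omega(\Theta_X)=\{\omega(\xi):\xi\in\Theta_X\}$; $\mu_0(\mathcal{F})=\dim_{\mathbb{C}}\mathcal{O}_2/\langle A,B\rangle$; $\operatorname{tang}(\mathcal{F},X,0)=\dim_{\mathbb{C}}\mathcal{O}_2/\langle\phi,v(\phi)\rangle$ (tangency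 order); $\tau_0(X)=\dim_{\mathbb{C}}\mathcal{O}_2/\langle\phi,\phi_x,\phi_y\rangle$ (Tjurina number). *)

theory Defs
  imports
    "HOL-Complex_Analysis.Complex_Analysis"
    "HOL-Computational_Algebra.Squarefree"
    "HOL-Library.Extended_Nat"
begin

section \<open>Holomorphic functions of two variables\<close>

text \<open>The Frechet derivative exists and is \<open>\<complex>\<close>-linear, i.e. of the form
  \<open>(h, k) \<mapsto> a h + b k\<close>.\<close>

definition cdiff2_at :: "(complex \<times> complex \<Rightarrow> complex) \<Rightarrow> complex \<times> complex \<Rightarrow> bool" where
  "cdiff2_at f z \<longleftrightarrow> (\<exists>a b. (f has_derivative (\<lambda>h. a * fst h + b * snd h)) (at z))"

definition holomorphic_near_0 :: "(complex \<times> complex \<Rightarrow> complex) \<Rightarrow> bool" where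
  "holomorphic_near_0 f \<longleftrightarrow> (\<forall>\<^sub>F z in nhds 0. cdiff2_at f z)"

lemma cdiff2_at_const: "cdiff2_at (\<lambda>_. c) z"
  unfolding cdiff2_at_def by (rule exI[of _ 0], rule exI[of _ 0]) simp

lemma cdiff2_at_add: "cdiff2_at f z \<Longrightarrow> cdiff2_at g z \<Longrightarrow> cdiff2_at (\<lambda>z. f z + g z) z"
  unfolding cdiff2_at_def
proof safe
  fix a b c d
  assume f: "(f has_derivative (\<lambda>h. a * fst h + b * snd h)) (at z)"
    and g: "(g has_derivative (\<lambda>h. c * fst h + d * snd h)) (at z)"
  have "((\<lambda>z. f z + g z) has_derivative (\<lambda>h. (a + c) * fst h + (b + d) * snd h)) (at z)"
    by (rule has_derivative_eq_rhs[OF has_derivative_add[OF f g]]) (simp add: algebra_simps)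
  then show "\<exists>a b. ((\<lambda>z. f z + g z) has_derivative (\<lambda>h. a * fst h + b * snd h)) (at z)"
    by blast
qed

lemma cdiff2_at_mult: "cdiff2_at f z \<Longrightarrow> cdiff2_at g z \<Longrightarrow> cdiff2_at (\<lambda>z. f z * g z) z"
  unfolding cdiff2_at_def
proof safe
  fix a b c d
  assume f: "(f has_derivative (\<lambda>h. a * fst h + b * snd h)) (at z)"
    and g: "(g has_derivative (\<lambda>h. c * fst h + d * snd h)) (at z)"
  have "((\<lambda>z. f z * g z) has_derivative
      (\<lambda>h. (f z * c + a * g z) * fst h + (f z * d + b * g z) * snd h)) (at z)"
    by (rule has_derivative_eq_rhs[OF has_derivative_mult[OF f g]]) (simp add: algebra_simps)
  then show "\<exists>a b. ((\<lambda>z. f z * g z) has_derivative (\<lambda>h. a * fst h + b * snd h)) (at z)"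
    by blast
qed

lemma cdiff2_at_uminus: "cdiff2_at f z \<Longrightarrow> cdiff2_at (\<lambda>z. - f z) z"
  using cdiff2_at_mult[OF cdiff2_at_const[of "-1"], of f z] by simp

lemma cdiff2_at_imp_isCont: "cdiff2_at f z \<Longrightarrow> isCont f z"
  unfolding cdiff2_at_def by (blast dest: has_derivative_continuous)

lemma cdiff2_at_affine:
  assumes "cdiff2_at f (p + t * c, q + t * d)"
  shows "(\<lambda>t. f (p + t * c, q + t * d)) field_differentiable (at t)"
proof -
  obtain a b where
    f: "(f has_derivative (\<lambda>h. a * fst h + b * snd h)) (at (p + t * c, q + t * d))"
    using assms unfolding cdiff2_at_def by blast
  have g: "((\<lambda>t. (p + t * c, q + t * d)) has_derivative (\<lambda>h. (h * c, h * d))) (at t)"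
    by (auto intro!: derivative_eq_intros)
  have "((\<lambda>t. f (p + t * c, q + t * d)) has_derivative (\<lambda>h. a * (h * c) + b * (h * d))) (at t)"
    by (rule has_derivative_eq_rhs[OF has_derivative_compose[OF g f]]) simp
  then have "((\<lambda>t. f (p + t * c, q + t * d)) has_derivative (*) (a * c + b * d)) (at t)"
    by (rule has_derivative_eq_rhs) (simp add: algebra_simps fun_eq_iff)
  then show ?thesis
    by (auto simp: field_differentiable_def has_field_derivative_def)
qed

lemma cdiff2_at_fst: "cdiff2_at f (x, y) \<Longrightarrow> (\<lambda>t. f (t, y)) field_differentiable (at x)"
  using cdiff2_at_affine[of f 0 x 1 y 0] by simp

lemma cdiff2_at_snd: "cdiff2_at f (x, y) \<Longrightarrow> (\<lambda>t. f (x, t)) field_differentiable (at y)"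
  using cdiff2_at_affine[of f x y 0 0 1] by simp

lemma cdiff2_at_swap:
  assumes "cdiff2_at f (prod.swap z)"
  shows "cdiff2_at (f \<circ> prod.swap) z"
proof -
  obtain a b where f: "(f has_derivative (\<lambda>h. a * fst h + b * snd h)) (at (prod.swap z))"
    using assms unfolding cdiff2_at_def by blast
  have g: "(prod.swap has_derivative prod.swap) (at z)" for z :: "complex \<times> complex"
    unfolding prod.swap_def by (auto intro!: derivative_eq_intros)
  have "((\<lambda>x. f (prod.swap x)) has_derivative (\<lambda>h. b * fst h + a * snd h)) (at z)"
    by (rule has_derivative_eq_rhs[OF has_derivative_compose[OF g f]]) (auto simp: algebra_simps)
  then show ?thesis
    unfolding cdiff2_at_def o_def by blast
qed

lemma nhds_0_polydisc_iff:
  "(\<forall>\<^sub>F z in nhds (0 :: complex \<times> complex). P z) \<longleftrightarrow>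
     (\<exists>r>0. \<forall>x\<in>ball 0 r. \<forall>y\<in>ball 0 r. P (x, y))"
proof
  assume "\<forall>\<^sub>F z in nhds (0 :: complex \<times> complex). P z"
  then have "\<forall>\<^sub>F z in nhds (0 :: complex) \<times>\<^sub>F nhds (0 :: complex). P z"
    by (simp add: nhds_prod zero_prod_def)
  then obtain Q R where Q: "eventually Q (nhds (0 :: complex))"
    and R: "eventually R (nhds (0 :: complex))" and P: "\<And>x y. Q x \<Longrightarrow> R y \<Longrightarrow> P (x, y)"
    unfolding eventually_prod_filter by blast
  from Q R obtain d e where "d > 0" "\<And>x. dist x 0 < d \<Longrightarrow> Q x" "e > 0" "\<And>x. dist x 0 < e \<Longrightarrow> R x"
    unfolding eventually_nhds_metric by blast
  then show "\<exists>r>0. \<forall>x\<in>ball 0 r. \<forall>y\<in>ball 0 r. P (x, y)"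
    by (intro exI[of _ "min d e"]) (auto intro!: P simp: dist_commute)
next
  assume "\<exists>r>0. \<forall>x\<in>ball 0 r. \<forall>y\<in>ball 0 r. P (x, y)"
  then obtain r where r: "r > 0" "\<forall>x\<in>ball 0 r. \<forall>y\<in>ball 0 r. P (x, y)" by blast
  have "open (ball (0::complex) r \<times> ball (0::complex) r)"
    by (intro open_Times) auto
  moreover have "0 \<in> ball (0::complex) r \<times> ball (0::complex) r"
    using r by (simp add: zero_prod_def)
  ultimately show "\<forall>\<^sub>F z in nhds (0 :: complex \<times> complex). P z"
    using r(2) unfolding eventually_nhds
    by (intro exI[of _ "ball 0 r \<times> ball 0 r"]) auto
qed

text \<open>The partial derivatives of a holomorphic function are holomorphic; this is what makes them
  operators on germs. The route is Cauchy's formula in one variable, followed by Osgood's lemma.\<close>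

lemma deriv_circle_integral:
  assumes R: "0 < R" and cont: "continuous_on (cball 0 R) f" and hol: "f holomorphic_on ball 0 R"
    and x: "x \<in> ball 0 R"
  shows "deriv f x = 1 / (2 * of_real pi * \<i>) * integral {0..1}
    (\<lambda>s. f (circlepath 0 R s) / (circlepath 0 R s - x)\<^sup>2 * vector_derivative (circlepath 0 R) (at s))"
  using DERIV_imp_deriv[OF Cauchy_derivative_integral_circlepath(2)[OF cont hol x]]
  by (simp add: contour_integral_integral)

lemma circlepath_ne:
  "x \<in> ball 0 R \<Longrightarrow> circlepath 0 R s - x \<noteq> 0"
proof
  assume x: "x \<in> ball 0 R" and eq: "circlepath 0 R s - x = 0"
  have "R > 0" using x by (metis ball_eq_empty empty_iff linorder_not_less)
  then have "norm (circlepath 0 R s) = R"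
    by (simp add: circlepath norm_mult)
  then show False using x eq by simp
qed

lemma circlepath_in: "0 < R \<Longrightarrow> R < S \<Longrightarrow> circlepath 0 R s \<in> ball 0 S"
  by (simp add: circlepath norm_mult)

lemma continuous_on_circlepath_UNIV [continuous_intros]:
  "continuous_on A g \<Longrightarrow> continuous_on A (\<lambda>s. circlepath 0 R (g s))"
  unfolding circlepath by (intro continuous_intros)

definition sep_holo :: "real \<Rightarrow> (complex \<times> complex \<Rightarrow> complex) \<Rightarrow> bool" where
  "sep_holo S f \<longleftrightarrow> continuous_on (ball 0 S \<times> ball 0 S) f \<and>
     (\<forall>y\<in>ball 0 S. (\<lambda>x. f (x, y)) holomorphic_on ball 0 S) \<and>
     (\<forall>x\<in>ball 0 S. (\<lambda>y. f (x, y)) holomorphic_on ball 0 S)"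

lemma sep_holo_swap: "sep_holo S f \<Longrightarrow> sep_holo S (f \<circ> prod.swap)"
  unfolding sep_holo_def
  by (auto simp: o_def intro!: continuous_intros elim!: continuous_on_compose2)

lemma deriv_fst_circle:
  assumes f: "sep_holo S f" and R: "0 < R" "R < S" and x: "x \<in> ball 0 R" and y: "y \<in> ball 0 S"
  shows "deriv (\<lambda>t. f (t, y)) x = 1 / (2 * of_real pi * \<i>) * integral {0..1}
    (\<lambda>s. f (circlepath 0 R s, y) / (circlepath 0 R s - x)\<^sup>2 *
      vector_derivative (circlepath 0 R) (at s))"
proof (rule deriv_circle_integral)
  have hol: "(\<lambda>x. f (x, y)) holomorphic_on ball 0 S"
    using f y by (auto simp: sep_holo_def)
  show "continuous_on (cball 0 R) (\<lambda>x. f (x, y))"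
    by (rule continuous_on_subset[OF holomorphic_on_imp_continuous_on[OF hol]]) (use R in auto)
  show "(\<lambda>x. f (x, y)) holomorphic_on ball 0 R"
    by (rule holomorphic_on_subset[OF hol]) (use R in auto)
qed (use R x in auto)

lemma continuous_deriv_fst:
  assumes f: "sep_holo S f" and R: "0 < R" "R < S"
  shows "continuous_on (ball 0 R \<times> ball 0 S) (\<lambda>(x, y). deriv (\<lambda>t. f (t, y)) x)"
proof -
  have cf: "continuous_on (ball 0 S \<times> ball 0 S) f" using f by (simp add: sep_holo_def)
  have "continuous_on (ball 0 R \<times> ball 0 S)
    (\<lambda>z. integral (cbox 0 1) (\<lambda>s. f (circlepath 0 R s, snd z) / (circlepath 0 R s - fst z)\<^sup>2 *
      (2 * pi * \<i> * R * exp (2 * of_real pi * \<i> * s))))"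
    by (rule integral_continuous_on_param, unfold split_beta)
      (intro continuous_intros continuous_on_compose2[OF cf],
        auto intro!: circlepath_in circlepath_ne R simp del: right_minus_eq mem_ball)
  then have "continuous_on (ball 0 R \<times> ball 0 S) (\<lambda>z. 1 / (2 * of_real pi * \<i>) *
      integral {0..1} (\<lambda>s. f (circlepath 0 R s, snd z) / (circlepath 0 R s - fst z)\<^sup>2 *
      vector_derivative (circlepath 0 R) (at s)))"
    by (intro continuous_intros) (simp add: vector_derivative_circlepath)
  then show ?thesis
    by (rule continuous_on_eq) (auto simp: deriv_fst_circle[OF f R] simp del: mem_ball)
qed

lemma continuous_deriv_snd:
  assumes f: "sep_holo S f" and R: "0 < R" "R < S"
  shows "continuous_on (ball 0 S \<times> ball 0 R) (\<lambda>(x, y). deriv (\<lambda>t. f (x, t)) y)"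
proof -
  have "continuous_on (ball 0 S \<times> ball 0 R)
      (\<lambda>z. (\<lambda>(x, y). deriv (\<lambda>t. (f \<circ> prod.swap) (t, y)) x) (prod.swap z))"
    by (rule continuous_on_compose2[OF continuous_deriv_fst[OF sep_holo_swap[OF f] R]])
      (auto intro!: continuous_intros)
  then show ?thesis by (simp add: o_def split_beta)
qed

lemma osgood:
  assumes f: "sep_holo S f" and x: "x \<in> ball 0 S" and y: "y \<in> ball 0 S"
  shows "cdiff2_at f (x, y)"
proof -
  define R where "R = (max (norm x) (norm y) + S) / 2"
  have "S > 0" using x norm_ge_zero[of x] by (simp del: norm_ge_zero)
  then have R: "0 < R" "R < S" and xR: "x \<in> ball 0 R" and yR: "y \<in> ball 0 R"
    using x y norm_ge_zero[of x] norm_ge_zero[of y] unfolding R_def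
    by (auto simp: max_def simp del: norm_ge_zero)
  let ?fy = "\<lambda>x y. blinfun_mult_right (deriv (\<lambda>t. f (x, t)) y)"
  have xd: "((\<lambda>x. f (x, y)) has_derivative (*) (deriv (\<lambda>t. f (t, y)) x)) (at x within ball 0 R)"
    using f x y holomorphic_derivI[OF _ open_ball x]
    by (auto simp: sep_holo_def has_field_derivative_def intro!: has_derivative_at_withinI)
  have yd: "((\<lambda>y. f (a, y)) has_derivative blinfun_apply (?fy a b)) (at b within ball 0 R)"
    if "a \<in> ball 0 R" "b \<in> ball 0 R" for a b
  proof -
    have "a \<in> ball 0 S" "b \<in> ball 0 S" using that R by auto
    then show ?thesis
      using f holomorphic_derivI[OF _ open_ball \<open>b \<in> ball 0 S\<close>]
      by (auto simp: sep_holo_def has_field_derivative_def intro!: has_derivative_at_withinI)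
  qed
  have "continuous_on (ball 0 R \<times> ball 0 R) (\<lambda>(x, y). deriv (\<lambda>t. f (x, t)) y)"
    by (rule continuous_on_subset[OF continuous_deriv_snd[OF f R]]) (use R in auto)
  then have "continuous_on (ball 0 R \<times> ball 0 R) (\<lambda>(x, y). ?fy x y)"
    unfolding split_beta by (intro continuous_intros)
  then have yc: "continuous (at (x, y) within ball 0 R \<times> ball 0 R) (\<lambda>(x, y). ?fy x y)"
    using xR yR by (auto simp: continuous_on_eq_continuous_within)
  have "((\<lambda>(x, y). f (x, y)) has_derivative
      (\<lambda>(tx, ty). deriv (\<lambda>t. f (t, y)) x * tx + blinfun_apply (?fy x y) ty))
      (at (x, y) within ball 0 R \<times> ball 0 R)"
    by (rule has_derivative_partialsI[OF xd yd yc yR convex_ball])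
  then have "(f has_derivative
      (\<lambda>h. deriv (\<lambda>t. f (t, y)) x * fst h + deriv (\<lambda>t. f (x, t)) y * snd h)) (at (x, y))"
    using xR yR by (simp add: case_prod_unfold at_within_open[OF _ open_Times[OF open_ball open_ball]])
  then show ?thesis unfolding cdiff2_at_def by blast
qed

lemma sep_holo_cdiff2:
  assumes "\<And>x y. x \<in> ball 0 S \<Longrightarrow> y \<in> ball 0 S \<Longrightarrow> cdiff2_at f (x, y)"
  shows "sep_holo S f"
  unfolding sep_holo_def
proof (intro conjI ballI)
  show "continuous_on (ball 0 S \<times> ball 0 S) f"
    using assms by (force intro!: continuous_at_imp_continuous_on cdiff2_at_imp_isCont)
qed (use assms in \<open>auto simp: holomorphic_on_def simp del: mem_ball
      intro!: field_differentiable_at_within cdiff2_at_fst cdiff2_at_snd\<close>)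

lemma sep_holo_deriv_fst:
  assumes f: "sep_holo S f" and R: "0 < R" "R < S"
  shows "sep_holo R (\<lambda>(x, y). deriv (\<lambda>t. f (t, y)) x)"
  unfolding sep_holo_def
proof (intro conjI ballI)
  show "continuous_on (ball 0 R \<times> ball 0 R) (\<lambda>(x, y). deriv (\<lambda>t. f (t, y)) x)"
    by (rule continuous_on_subset[OF continuous_deriv_fst[OF f R]]) (use R in auto)
next
  fix y :: complex assume "y \<in> ball 0 R"
  then have "(\<lambda>x. f (x, y)) holomorphic_on ball 0 R"
    using f R by (auto simp: sep_holo_def intro: holomorphic_on_subset[of _ "ball 0 S"])
  then show "(\<lambda>x. case (x, y) of (x, y) \<Rightarrow> deriv (\<lambda>t. f (t, y)) x) holomorphic_on ball 0 R"
    by (simp add: holomorphic_deriv)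
next
  fix x :: complex assume x: "x \<in> ball 0 R"
  define K where "K = (\<lambda>s. 2 * pi * \<i> * R * exp (2 * of_real pi * \<i> * s) / (circlepath 0 R s - x)\<^sup>2)"
  have cf: "continuous_on (ball 0 S \<times> ball 0 S) f" using f by (simp add: sep_holo_def)
  have K: "continuous_on A K" for A
    unfolding K_def by (intro continuous_intros) (use x circlepath_ne in auto)
  define T where "T = (R + S) / 2"
  have T: "0 < T" "T < S" "R < T" using R by (auto simp: T_def)
  have "((\<lambda>y. integral (cbox 0 1) (\<lambda>s. f (circlepath 0 R s, y) * K s)) has_field_derivative
      integral (cbox 0 1) (\<lambda>s. deriv (\<lambda>t. f (circlepath 0 R s, t)) y * K s)) (at y within ball 0 R)"
    if y: "y \<in> ball 0 R" for y
  proof (rule leibniz_rule_field_derivative)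
    fix b and s :: real assume b: "b \<in> ball (0::complex) R"
    have "(\<lambda>t. f (circlepath 0 R s, t)) holomorphic_on ball 0 S"
      using f circlepath_in[OF R] by (auto simp: sep_holo_def)
    then have "((\<lambda>t. f (circlepath 0 R s, t)) has_field_derivative
        deriv (\<lambda>t. f (circlepath 0 R s, t)) b) (at b)"
      by (rule holomorphic_derivI) (use b R in auto)
    then show "((\<lambda>b. f (circlepath 0 R s, b) * K s) has_field_derivative
        deriv (\<lambda>t. f (circlepath 0 R s, t)) b * K s) (at b within ball 0 R)"
      by (rule DERIV_cmult_right[OF has_field_derivative_at_within])
  next
    fix b assume "b \<in> ball (0::complex) R"
    then show "(\<lambda>s. f (circlepath 0 R s, b) * K s) integrable_on cbox 0 1"
      by (intro integrable_continuous continuous_intros K continuous_on_compose2[OF cf])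
        (use circlepath_in[OF R] R in auto)
  next
    show "continuous_on (ball 0 R \<times> cbox 0 1)
        (\<lambda>(y, s). deriv (\<lambda>t. f (circlepath 0 R s, t)) y * K s)"
      unfolding split_beta
    proof (intro continuous_intros continuous_on_compose2[OF K[of UNIV]])
      have "continuous_on (ball 0 R \<times> cbox 0 1)
          (\<lambda>z. (\<lambda>(x, y). deriv (\<lambda>t. f (x, t)) y) (circlepath 0 R (snd z), fst z))"
        by (rule continuous_on_compose2[OF continuous_deriv_snd[OF f T(1,2)]])
          (use T circlepath_in[OF R] in \<open>auto intro!: continuous_intros\<close>)
      then show "continuous_on (ball 0 R \<times> cbox 0 1)
          (\<lambda>z. deriv (\<lambda>t. f (circlepath 0 R (snd z), t)) (fst z))"
        by simp
    qed auto
  qed (use y in auto)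
  then have "(\<lambda>y. 1 / (2 * of_real pi * \<i>) *
      integral (cbox 0 1) (\<lambda>s. f (circlepath 0 R s, y) * K s)) holomorphic_on ball 0 R"
    unfolding holomorphic_on_def field_differentiable_def
    by (intro ballI exI, rule DERIV_cmult, simp only: mem_ball)
  moreover have "deriv (\<lambda>t. f (t, y)) x = 1 / (2 * of_real pi * \<i>) *
      integral (cbox 0 1) (\<lambda>s. f (circlepath 0 R s, y) * K s)" if "y \<in> ball 0 R" for y
  proof -
    have "y \<in> ball 0 S" using that R by auto
    then show ?thesis
      by (simp add: deriv_fst_circle[OF f R x] K_def vector_derivative_circlepath)
  qed
  ultimately show "(\<lambda>y. case (x, y) of (x, y) \<Rightarrow> deriv (\<lambda>t. f (t, y)) x) holomorphic_on ball 0 R"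
    by (subst holomorphic_cong[OF refl]) auto
qed

definition partial_x :: "(complex \<times> complex \<Rightarrow> complex) \<Rightarrow> complex \<times> complex \<Rightarrow> complex" where
  "partial_x f = (\<lambda>(x, y). deriv (\<lambda>t. f (t, y)) x)"

definition partial_y :: "(complex \<times> complex \<Rightarrow> complex) \<Rightarrow> complex \<times> complex \<Rightarrow> complex" where
  "partial_y f = (\<lambda>(x, y). deriv (\<lambda>t. f (x, t)) y)"

lemma holomorphic_near_0_iff_sep_holo:
  "holomorphic_near_0 f \<longleftrightarrow> (\<exists>S>0. sep_holo S f)"
  unfolding holomorphic_near_0_def nhds_0_polydisc_iff
  using osgood sep_holo_cdiff2 by meson

lemma holomorphic_near_0_partial_x: "holomorphic_near_0 f \<Longrightarrow> holomorphic_near_0 (partial_x f)"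
  unfolding holomorphic_near_0_iff_sep_holo partial_x_def
proof safe
  fix S :: real assume "S > 0" "sep_holo S f"
  then show "\<exists>S>0. sep_holo S (\<lambda>(x, y). deriv (\<lambda>t. f (t, y)) x)"
    by (intro exI[of _ "S / 2"] conjI sep_holo_deriv_fst) auto
qed

lemma partial_y_swap: "partial_y f = partial_x (f \<circ> prod.swap) \<circ> prod.swap"
  by (auto simp: partial_x_def partial_y_def fun_eq_iff)

lemma holomorphic_near_0_partial_y: "holomorphic_near_0 f \<Longrightarrow> holomorphic_near_0 (partial_y f)"
  unfolding partial_y_swap
  by (metis holomorphic_near_0_iff_sep_holo holomorphic_near_0_partial_x sep_holo_swap)

lemma eventually_partial_cong:
  assumes "\<forall>\<^sub>F z in nhds 0. f z = g z"
  shows "\<forall>\<^sub>F z in nhds 0. partial_x f z = partial_x g z"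
    and "\<forall>\<^sub>F z in nhds 0. partial_y f z = partial_y g z"
proof -
  obtain r where r: "r > 0" "\<And>x y. x \<in> ball 0 r \<Longrightarrow> y \<in> ball 0 r \<Longrightarrow> f (x, y) = g (x, y)"
    using assms unfolding nhds_0_polydisc_iff by blast
  have ev: "\<forall>\<^sub>F t in nhds x. t \<in> ball 0 r" if "x \<in> ball 0 r" for x :: complex
    using that eventually_nhds_in_open open_ball by blast
  have "partial_x f (x, y) = partial_x g (x, y) \<and> partial_y f (x, y) = partial_y g (x, y)"
    if "x \<in> ball 0 r" "y \<in> ball 0 r" for x y
    unfolding partial_x_def partial_y_def
    by (auto intro!: deriv_cong_ev eventually_mono[OF ev] r(2) that simp del: mem_ball)
  then show "\<forall>\<^sub>F z in nhds 0. partial_x f z = partial_x g z"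
    and "\<forall>\<^sub>F z in nhds 0. partial_y f z = partial_y g z"
    unfolding nhds_0_polydisc_iff using r(1) by blast+
qed


section \<open>The ring of germs at the origin\<close>

definition germ_eq ::
    "(complex \<times> complex \<Rightarrow> complex) \<Rightarrow> (complex \<times> complex \<Rightarrow> complex) \<Rightarrow> bool" where
  "germ_eq f g \<longleftrightarrow>
     holomorphic_near_0 f \<and> holomorphic_near_0 g \<and> (\<forall>\<^sub>F z in nhds 0. f z = g z)"

quotient_type germ = "complex \<times> complex \<Rightarrow> complex" / partial: germ_eq
proof (rule part_equivpI)
  show "\<exists>f. germ_eq f f"
    by (rule exI[of _ "\<lambda>_. 0"])
      (auto simp: germ_eq_def holomorphic_near_0_def cdiff2_at_const)
  show "symp germ_eq"
    by (auto simp: symp_def germ_eq_def elim: eventually_mono)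
  show "transp germ_eq"
    by (auto simp: transp_def germ_eq_def elim: eventually_elim2)
qed

lemma holomorphic_near_0_const: "holomorphic_near_0 (\<lambda>_. c)"
  by (simp add: holomorphic_near_0_def cdiff2_at_const)

lemma holomorphic_near_0_add:
  "holomorphic_near_0 f \<Longrightarrow> holomorphic_near_0 g \<Longrightarrow> holomorphic_near_0 (\<lambda>z. f z + g z)"
  unfolding holomorphic_near_0_def by (erule (1) eventually_elim2) (rule cdiff2_at_add)

lemma holomorphic_near_0_mult:
  "holomorphic_near_0 f \<Longrightarrow> holomorphic_near_0 g \<Longrightarrow> holomorphic_near_0 (\<lambda>z. f z * g z)"
  unfolding holomorphic_near_0_def by (erule (1) eventually_elim2) (rule cdiff2_at_mult)

lemma holomorphic_near_0_uminus:
  "holomorphic_near_0 f \<Longrightarrow> holomorphic_near_0 (\<lambda>z. - f z)"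
  unfolding holomorphic_near_0_def by (elim eventually_mono) (rule cdiff2_at_uminus)

lemma holomorphic_near_0_diff:
  "holomorphic_near_0 f \<Longrightarrow> holomorphic_near_0 g \<Longrightarrow> holomorphic_near_0 (\<lambda>z. f z - g z)"
  using holomorphic_near_0_add[OF _ holomorphic_near_0_uminus, of f g] by simp

lemma germ_zero_divisor:
  assumes f: "holomorphic_near_0 f" and g: "holomorphic_near_0 g"
    and fg: "\<forall>\<^sub>F z in nhds 0. f z * g z = 0" and nf: "\<not> (\<forall>\<^sub>F z in nhds 0. f z = 0)"
  shows "\<forall>\<^sub>F z in nhds 0. g z = 0"
proof -
  have "\<forall>\<^sub>F z in nhds 0. cdiff2_at f z \<and> cdiff2_at g z \<and> f z * g z = 0"
    using f g fg by (auto simp: holomorphic_near_0_def intro: eventually_conj)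
  then obtain r where r: "r > 0" and
    D: "\<And>x y. x \<in> ball 0 r \<Longrightarrow> y \<in> ball 0 r \<Longrightarrow>
        cdiff2_at f (x, y) \<and> cdiff2_at g (x, y) \<and> f (x, y) * g (x, y) = 0"
    unfolding nhds_0_polydisc_iff by blast
  obtain p q where pq: "p \<in> ball 0 r" "q \<in> ball 0 r" "f (p, q) \<noteq> 0"
    using nf r unfolding nhds_0_polydisc_iff by blast
  have "g (x, y) = 0" if xy: "x \<in> ball 0 r" "y \<in> ball 0 r" for x y
  proof -
    define l where "l = (\<lambda>t. (p + t * (x - p), q + t * (y - q)))"
    define U where "U = l -` (ball 0 r \<times> ball 0 r)"
    have lin: "linear (\<lambda>t. t * c)" for c :: complex
      by (rule bounded_linear.linear[OF bounded_linear_mult_left])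
    have U_eq: "U = (\<lambda>t. t * (x - p)) -` ball (- p) r \<inter> (\<lambda>t. t * (y - q)) -` ball (- q) r"
      by (auto simp: U_def l_def dist_norm norm_minus_commute algebra_simps)
    have "convex U"
      unfolding U_eq by (intro convex_Int convex_linear_vimage lin convex_ball)
    then have conn: "connected U" by (rule convex_connected)
    have cl: "continuous_on A l" for A
      unfolding l_def by (intro continuous_intros)
    have op: "open U"
      unfolding U_def by (intro open_vimage open_Times open_ball cl)
    have 0: "0 \<in> U" and 1: "1 \<in> U"
      using pq xy by (auto simp: U_def l_def)
    have hol: "(\<lambda>t. g (l t)) holomorphic_on U" and holf: "(\<lambda>t. f (l t)) holomorphic_on U"
      unfolding holomorphic_on_def l_def
      by (auto intro!: field_differentiable_at_within cdiff2_at_affine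
          simp: U_def l_def D simp del: mem_ball)
    have "isCont (\<lambda>t. f (l t)) 0"
      using holomorphic_on_imp_continuous_on[OF holf] op 0 continuous_on_eq_continuous_at by blast
    then have "((\<lambda>t. f (l t)) \<longlongrightarrow> f (l 0)) (nhds 0)"
      using tendsto_at_iff_tendsto_nhds[of "\<lambda>t. f (l t)" 0] by (simp add: isCont_def)
    then have "\<forall>\<^sub>F t in nhds 0. f (l t) \<noteq> 0"
      by (rule tendsto_imp_eventually_ne) (use pq(3) in \<open>simp add: l_def\<close>)
    then have "\<forall>\<^sub>F t in nhds 0. f (l t) \<noteq> 0 \<and> t \<in> U"
      using op 0 by (intro eventually_conj eventually_nhds_in_open)
    then obtain V where V: "open V" "0 \<in> V" "\<And>t. t \<in> V \<Longrightarrow> f (l t) \<noteq> 0 \<and> t \<in> U"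
      unfolding eventually_nhds by blast
    have "g (l t) = 0" if "t \<in> V" for t
    proof -
      have "f (l t) \<noteq> 0" "l t \<in> ball 0 r \<times> ball 0 r" using V(3)[OF that] by (auto simp: U_def)
      then show ?thesis using D[of "fst (l t)" "snd (l t)"] by (auto simp: mem_Times_iff)
    qed
    then have "g (l 1) = 0"
      using analytic_continuation_open[OF V(1) op _ conn _ hol, of "\<lambda>_. 0"] V 1 by auto
    then show ?thesis by (simp add: l_def)
  qed
  then show ?thesis
    unfolding nhds_0_polydisc_iff using r by blast
qed

instantiation germ :: comm_ring_1
begin

lift_definition zero_germ :: germ is "\<lambda>_. 0"
  by (simp add: germ_eq_def holomorphic_near_0_const)

lift_definition one_germ :: germ is "\<lambda>_. 1"
  by (simp add: germ_eq_def holomorphic_near_0_const)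

lift_definition plus_germ :: "germ \<Rightarrow> germ \<Rightarrow> germ" is "\<lambda>f g z. f z + g z"
  by (auto simp: germ_eq_def holomorphic_near_0_add elim: eventually_elim2)

lift_definition uminus_germ :: "germ \<Rightarrow> germ" is "\<lambda>f z. - f z"
  by (auto simp: germ_eq_def holomorphic_near_0_uminus elim: eventually_mono)

lift_definition minus_germ :: "germ \<Rightarrow> germ \<Rightarrow> germ" is "\<lambda>f g z. f z - g z"
  by (auto simp: germ_eq_def holomorphic_near_0_diff elim: eventually_elim2)

lift_definition times_germ :: "germ \<Rightarrow> germ \<Rightarrow> germ" is "\<lambda>f g z. f z * g z"
  by (auto simp: germ_eq_def holomorphic_near_0_mult elim: eventually_elim2)

instance
proof
  show "(0::germ) \<noteq> 1"
    by transfer (simp add: germ_eq_def)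
qed (transfer; simp add: germ_eq_def holomorphic_near_0_const holomorphic_near_0_add
      holomorphic_near_0_mult holomorphic_near_0_uminus holomorphic_near_0_diff algebra_simps)+

end

instance germ :: idom
proof
  fix a b :: germ
  assume "a \<noteq> 0" "b \<noteq> 0"
  then show "a * b \<noteq> 0"
  proof transfer
    fix f g
    assume fg: "germ_eq f f" "germ_eq g g" "\<not> germ_eq f (\<lambda>_. 0)" "\<not> germ_eq g (\<lambda>_. 0)"
    then have "\<not> (\<forall>\<^sub>F z in nhds 0. f z = 0)" "\<not> (\<forall>\<^sub>F z in nhds 0. g z = 0)"
      by (simp_all add: germ_eq_def holomorphic_near_0_const)
    with fg germ_zero_divisor[of f g] show "\<not> germ_eq (\<lambda>z. f z * g z) (\<lambda>_. 0)"
      unfolding germ_eq_def by blast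
  qed
qed

text \<open>Division is only needed because the library's \<^const>\<open>coprime\<close> is tied to a class which
  includes it.\<close>

instantiation germ :: algebraic_semidom
begin

definition divide_germ :: "germ \<Rightarrow> germ \<Rightarrow> germ" where
  "divide_germ a b = (if b \<noteq> 0 \<and> b dvd a then (THE c. a = c * b) else 0)"

instance
proof
  fix a b :: germ
  show "a * b div b = a" if "b \<noteq> 0"
  proof -
    have "(THE c. a * b = c * b) = a" using that by (intro the_equality) simp_all
    then show ?thesis using that by (simp add: divide_germ_def)
  qed
  show "a div 0 = 0"
    by (simp add: divide_germ_def)
qed

end

lift_definition germ_const :: "complex \<Rightarrow> germ" is "\<lambda>c _. c"
  by (simp add: germ_eq_def holomorphic_near_0_const)

lift_definition germ_value :: "germ \<Rightarrow> complex" is "\<lambda>f. f 0"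
  by (auto simp: germ_eq_def dest: eventually_nhds_x_imp_x)

lift_definition germ_dx :: "germ \<Rightarrow> germ" is partial_x
  by (auto simp: germ_eq_def holomorphic_near_0_partial_x eventually_partial_cong)

lift_definition germ_dy :: "germ \<Rightarrow> germ" is partial_y
  by (auto simp: germ_eq_def holomorphic_near_0_partial_y eventually_partial_cong)

definition germ_scale :: "complex \<Rightarrow> germ \<Rightarrow> germ" where
  "germ_scale c f = germ_const c * f"

lemma germ_const_add: "germ_const (a + b) = germ_const a + germ_const b"
  by transfer (simp add: germ_eq_def holomorphic_near_0_const)

lemma germ_const_mult: "germ_const (a * b) = germ_const a * germ_const b"
  by transfer (simp add: germ_eq_def holomorphic_near_0_const)

lemma germ_const_1: "germ_const 1 = 1"
  by transfer (simp add: germ_eq_def holomorphic_near_0_const)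

global_interpretation germ_vec: vector_space germ_scale
  by standard
    (simp_all add: germ_scale_def germ_const_add germ_const_mult germ_const_1 algebra_simps)

text \<open>The ring as a module over itself is deliberately not interpreted globally: its simp rule
  \<open>scale_scale\<close> would loop with associativity.\<close>

lemma module_germ: "module ((*) :: germ \<Rightarrow> germ \<Rightarrow> germ)"
  by standard (simp_all add: algebra_simps)

definition ideal_generated :: "germ set \<Rightarrow> germ set" where
  "ideal_generated = module.span (*)"

lemmas ideal_generated_zero = module.span_zero[OF module_germ, folded ideal_generated_def]
lemmas ideal_generated_add = module.span_add[OF module_germ, folded ideal_generated_def]
lemmas ideal_generated_mult = module.span_scale[OF module_germ, folded ideal_generated_def]


section \<open>Complex dimension of quotients\<close>

text \<open>\<open>quotient_basis J n b\<close> says that the classes of \<open>b 0, \<dots>, b (n - 1)\<close> form a basis of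
  \<open>\<O>\<^sub>2 / J\<close> over \<open>\<complex>\<close>.\<close>

definition quotient_basis :: "germ set \<Rightarrow> nat \<Rightarrow> (nat \<Rightarrow> germ) \<Rightarrow> bool" where
  "quotient_basis J n b \<longleftrightarrow>
     (\<forall>g. \<exists>c. g - (\<Sum>i<n. germ_scale (c i) (b i)) \<in> J) \<and>
     (\<forall>c. (\<Sum>i<n. germ_scale (c i) (b i)) \<in> J \<longrightarrow> (\<forall>i<n. c i = 0))"

definition quotient_dim :: "germ set \<Rightarrow> enat" where
  "quotient_dim J =
     (if \<exists>n b. quotient_basis J n b then enat (THE n. \<exists>b. quotient_basis J n b) else \<infinity>)"

lemma quotient_basis_card_le:
  assumes J: "germ_vec.subspace J" and b: "quotient_basis J n b" and c: "quotient_basis J m c"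
  shows "m \<le> n"
proof -
  have "\<exists>w. c j - (\<Sum>i<n. germ_scale (w i) (b i)) \<in> J" for j
    using b by (auto simp: quotient_basis_def)
  then obtain w where w: "\<And>j. c j - (\<Sum>i<n. germ_scale (w j i) (b i)) \<in> J"
    by metis
  define d where "d = (\<lambda>j. \<Sum>i<n. germ_scale (w j i) (b i))"
  have zero: "\<forall>j<m. a j = 0" if "(\<Sum>j<m. germ_scale (a j) (d j)) = 0" for a
  proof -
    have "(\<Sum>j<m. germ_scale (a j) (c j - d j)) \<in> J"
      using w J by (intro germ_vec.subspace_sum germ_vec.subspace_scale) (auto simp: d_def)
    then have "(\<Sum>j<m. germ_scale (a j) (c j)) \<in> J"
      by (simp add: germ_vec.scale_right_diff_distrib sum_subtractf that)
    then show ?thesis using c by (auto simp: quotient_basis_def)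
  qed
  have inj: "inj_on d {..<m}"
  proof (rule inj_onI, rule ccontr)
    fix i j assume ij: "i \<in> {..<m}" "j \<in> {..<m}" "d i = d j" "i \<noteq> j"
    define a where "a = (\<lambda>k. if k = i then 1 else if k = j then -1 else (0::complex))"
    have "(\<Sum>k<m. germ_scale (a k) (d k)) = (\<Sum>k\<in>{i, j}. germ_scale (a k) (d k))"
      using ij by (intro sum.mono_neutral_right) (auto simp: a_def)
    also have "\<dots> = 0" using ij by (simp add: a_def)
    finally show False using zero[of a] ij by (auto simp: a_def)
  qed
  have ind: "germ_vec.independent (d ` {..<m})"
  proof (rule germ_vec.independent_if_scalars_zero)
    fix a x assume s: "(\<Sum>x\<in>d ` {..<m}. germ_scale (a x) x) = 0" and x: "x \<in> d ` {..<m}"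
    then have "(\<Sum>j<m. germ_scale (a (d j)) (d j)) = 0"
      by (simp add: sum.reindex[OF inj])
    then show "a x = 0" using zero[of "\<lambda>j. a (d j)"] x by auto
  qed auto
  have "d ` {..<m} \<subseteq> germ_vec.span (b ` {..<n})"
    unfolding d_def
    by (clarsimp, intro germ_vec.span_sum germ_vec.span_scale germ_vec.span_base) auto
  then have "card (d ` {..<m}) \<le> card (b ` {..<n})"
    using germ_vec.independent_span_bound[OF _ ind] by auto
  then show ?thesis
    using card_image[OF inj] card_image_le[of "{..<n}" b] by simp
qed

lemma quotient_dim_eq:
  assumes "germ_vec.subspace J" "quotient_basis J n b"
  shows "quotient_dim J = enat n"
proof -
  have "(THE n. \<exists>b. quotient_basis J n b) = n"
    using assms quotient_basis_card_le by (blast intro: the_equality antisym)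
  then show ?thesis using assms(2) by (auto simp: quotient_dim_def)
qed


section \<open>Foliations and curves\<close>

text \<open>A 1-form \<open>A dx + B dy\<close> and a vector field \<open>P \<partial>/\<partial>x + Q \<partial>/\<partial>y\<close> are given by their pairs of
  coefficients \<open>(A, B)\<close> and \<open>(P, Q)\<close>.\<close>

type_synonym one_form = "germ \<times> germ"
type_synonym vector_field = "germ \<times> germ"

definition pairing :: "one_form \<Rightarrow> vector_field \<Rightarrow> germ" where
  "pairing \<omega> \<xi> = fst \<omega> * fst \<xi> + snd \<omega> * snd \<xi>"

definition differential :: "germ \<Rightarrow> one_form" where
  "differential f = (germ_dx f, germ_dy f)"

text \<open>The coefficient of \<open>dx \<and> dy\<close> in \<open>\<omega> \<and> \<eta>\<close>.\<close>

definition wedge :: "one_form \<Rightarrow> one_form \<Rightarrow> germ" where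
  "wedge \<omega> \<eta> = fst \<omega> * snd \<eta> - snd \<omega> * fst \<eta>"

definition dual_field :: "one_form \<Rightarrow> vector_field" where
  "dual_field \<omega> = (- snd \<omega>, fst \<omega>)"

definition apply_field :: "vector_field \<Rightarrow> germ \<Rightarrow> germ" where
  "apply_field \<xi> f = fst \<xi> * germ_dx f + snd \<xi> * germ_dy f"

definition foliation :: "one_form \<Rightarrow> bool" where
  "foliation \<omega> \<longleftrightarrow> coprime (fst \<omega>) (snd \<omega>)"

definition singular :: "one_form \<Rightarrow> bool" where
  "singular \<omega> \<longleftrightarrow> germ_value (fst \<omega>) = 0 \<and> germ_value (snd \<omega>) = 0"

definition invariant_curve :: "one_form \<Rightarrow> germ \<Rightarrow> bool" where
  "invariant_curve \<omega> f \<longleftrightarrow> f dvd wedge \<omega> (differential f)"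

text \<open>A germ of a reduced curve \<open>X\<close> is given by a reduced equation \<open>\<phi>\<close>. The curve passes through
  the origin, and its irreducible components are the curves \<open>{f = 0}\<close> for the irreducible factors
  \<open>f\<close> of \<open>\<phi>\<close>.\<close>

definition reduced_equation :: "germ \<Rightarrow> bool" where
  "reduced_equation \<phi> \<longleftrightarrow> \<phi> \<noteq> 0 \<and> germ_value \<phi> = 0 \<and> squarefree \<phi>"

definition no_invariant_component :: "one_form \<Rightarrow> germ \<Rightarrow> bool" where
  "no_invariant_component \<omega> \<phi> \<longleftrightarrow> (\<forall>f. irreducible f \<and> f dvd \<phi> \<longrightarrow> \<not> invariant_curve \<omega> f)"

definition log_fields :: "germ \<Rightarrow> vector_field set" where
  "log_fields \<phi> = {\<xi>. pairing (differential \<phi>) \<xi> \<in> ideal_generated {\<phi>}}"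

definition mu_BR :: "one_form \<Rightarrow> germ \<Rightarrow> enat" where
  "mu_BR \<omega> \<phi> = quotient_dim (pairing \<omega> ` log_fields \<phi>)"

definition milnor_number :: "one_form \<Rightarrow> enat" where
  "milnor_number \<omega> = quotient_dim (ideal_generated {fst \<omega>, snd \<omega>})"

definition tangency_order :: "one_form \<Rightarrow> germ \<Rightarrow> enat" where
  "tangency_order \<omega> \<phi> = quotient_dim (ideal_generated {\<phi>, apply_field (dual_field \<omega>) \<phi>})"

definition tjurina_number :: "germ \<Rightarrow> enat" where
  "tjurina_number \<phi> = quotient_dim (ideal_generated {\<phi>, germ_dx \<phi>, germ_dy \<phi>})"

lemma subspace_ideal_generated: "germ_vec.subspace (ideal_generated S)"
  unfolding germ_vec.subspace_def germ_scale_def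
  by (simp add: ideal_generated_zero ideal_generated_add ideal_generated_mult)

lemma subspace_pairing_log_fields: "germ_vec.subspace (pairing \<omega> ` log_fields \<phi>)"
proof -
  have add: "pairing \<alpha> (\<xi> + \<eta>) = pairing \<alpha> \<xi> + pairing \<alpha> \<eta>" for \<alpha> \<xi> \<eta>
    by (simp add: pairing_def algebra_simps)
  have scale: "pairing \<alpha> (k * fst \<xi>, k * snd \<xi>) = k * pairing \<alpha> \<xi>" for \<alpha> \<xi> k
    by (simp add: pairing_def algebra_simps)
  have zero: "pairing \<alpha> 0 = 0" for \<alpha>
    by (simp add: pairing_def)
  show ?thesis
    unfolding germ_vec.subspace_def germ_scale_def
  proof (intro conjI ballI allI)
    show "0 \<in> pairing \<omega> ` log_fields \<phi>"
      by (rule image_eqI[of _ _ 0]) (simp_all add: log_fields_def zero ideal_generated_zero)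
  next
    fix x y assume "x \<in> pairing \<omega> ` log_fields \<phi>" "y \<in> pairing \<omega> ` log_fields \<phi>"
    then obtain \<xi> \<eta> where "x = pairing \<omega> \<xi>" "y = pairing \<omega> \<eta>" "\<xi> \<in> log_fields \<phi>" "\<eta> \<in> log_fields \<phi>"
      by blast
    then show "x + y \<in> pairing \<omega> ` log_fields \<phi>"
      by (intro image_eqI[of _ _ "\<xi> + \<eta>"]) (simp_all add: log_fields_def add ideal_generated_add)
  next
    fix k x assume "x \<in> pairing \<omega> ` log_fields \<phi>"
    then obtain \<xi> where "x = pairing \<omega> \<xi>" "\<xi> \<in> log_fields \<phi>" by blast
    then show "germ_const k * x \<in> pairing \<omega> ` log_fields \<phi>"
      by (intro image_eqI[of _ _ "(germ_const k * fst \<xi>, germ_const k * snd \<xi>)"])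
        (simp_all add: log_fields_def scale ideal_generated_mult)
  qed
qed

end

theory Submission
  imports Defs
begin

text \<open>Since \<open>\<omega>\<close> and \<open>d\<phi>\<close> induce isomorphisms of \<open>\<O>\<^sub>2\<^sup>2 / (\<Theta>\<^sub>X + \<O>\<^sub>2 v)\<close> onto \<open>\<langle>A, B\<rangle> / \<omega>(\<Theta>\<^sub>X)\<close> and
  onto \<open>\<langle>\<phi>, \<phi>\<^sub>x, \<phi>\<^sub>y\<rangle> / \<langle>\<phi>, v(\<phi>)\<rangle>\<close>, both \<open>\<mu>\<^sub>B\<^sub>R - \<mu>\<^sub>0\<close> and \<open>tang - \<tau>\<^sub>0\<close> are the dimension of that quotient.
  Finiteness and the injectivity of the first map need that coprime germs \<open>f\<close>, \<open>g\<close> form a regular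
  sequence of finite colength. After a shear, \<open>f\<close> does not vanish identically on \<open>x = 0\<close>. Every ideal
  that contains such an \<open>f\<close> and is saturated with respect to \<open>x\<close> is principal; applied to \<open>(f : g)\<close>
  this gives regularity, and applied to the \<open>x\<close>-saturation of \<open>(f, g)\<close> it gives a power of \<open>x\<close> in
  \<open>(f, g)\<close>.\<close>

section \<open>Separately holomorphic functions\<close>

text \<open>The obstacle is convergence. Repeated division by a generator \<open>p\<close> of a
  saturated ideal yields a quotient that is only a formal power series in x, with coefficients
  holomorphic in y on a fixed disc. A Cauchy integral of \<open>H / P\<close> over a circle avoiding
  the zeros of \<open>P\<close> supplies a convergent candidate, and the remaining error is flat
  along x = 0. The order of vanishing on x = 0 plays the part of a Euclidean norm: modulo x every
  germ is zero or a unit times a power of y. It yields principal generators, finite spanning sets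
  and irreducible factors. Reducedness and non-invariance enter through a single fact, the
  coprimality of \<phi> and v(\<phi>). It makes the tangency order finite, and hence the Tjurina
  number, which belongs to a larger ideal.\<close>

lemma sep_holo_subset: "sep_holo S f \<Longrightarrow> R \<le> S \<Longrightarrow> sep_holo R f"
  unfolding sep_holo_def using subset_ball[of R S 0]
  by (meson Sigma_mono continuous_on_subset holomorphic_on_subset subsetD)

lemma sep_holo_fst: "sep_holo S fst" and sep_holo_snd_comp:
  "f holomorphic_on ball 0 S \<Longrightarrow> sep_holo S (\<lambda>z. f (snd z))"
  unfolding sep_holo_def
  by (auto intro!: continuous_intros holomorphic_intros
      continuous_on_compose2[OF holomorphic_on_imp_continuous_on[of f "ball 0 S"]])

lemma sep_holo_diff: "sep_holo S f \<Longrightarrow> sep_holo S g \<Longrightarrow> sep_holo S (\<lambda>z. f z - g z)"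
  and sep_holo_mult: "sep_holo S f \<Longrightarrow> sep_holo S g \<Longrightarrow> sep_holo S (\<lambda>z. f z * g z)"
  unfolding sep_holo_def by (auto intro!: continuous_intros holomorphic_intros)

lemma sep_holo_inverse:
  "sep_holo S f \<Longrightarrow> (\<And>z. z \<in> ball 0 S \<times> ball 0 S \<Longrightarrow> f z \<noteq> 0) \<Longrightarrow> sep_holo S (\<lambda>z. inverse (f z))"
  unfolding sep_holo_def by (auto intro!: continuous_intros holomorphic_intros)

text \<open>The integral formula for the derivative gives continuity only on strictly smaller
  polydiscs; as continuity is local, these exhaust the full one.\<close>

lemma continuous_on_ball_UN:
  fixes f :: "complex \<times> complex \<Rightarrow> complex"
  assumes "\<And>R. 0 < R \<Longrightarrow> R < S \<Longrightarrow> continuous_on (ball 0 R \<times> ball 0 R) f"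
  shows "continuous_on (ball 0 S \<times> ball 0 S) f"
proof (rule continuous_at_imp_continuous_on, rule ballI)
  fix z :: "complex \<times> complex" assume z: "z \<in> ball 0 S \<times> ball 0 S"
  define R where "R = (max (norm (fst z)) (norm (snd z)) + S) / 2"
  have lt: "norm (fst z) < S" "norm (snd z) < S" using z by (auto simp: mem_Times_iff)
  moreover have "0 < S" using lt norm_ge_zero[of "fst z"] by linarith
  ultimately have "0 < R" "R < S" "norm (fst z) < R" "norm (snd z) < R"
    using norm_ge_zero[of "fst z"] unfolding R_def by (auto simp: max_def simp del: norm_ge_zero)
  then have "continuous_on (ball 0 R \<times> ball 0 R) f" "z \<in> ball 0 R \<times> ball 0 R"
    using assms[of R] by (auto simp: mem_Times_iff)
  then show "isCont f z"
    using continuous_on_eq_continuous_at[OF open_Times[OF open_ball open_ball]] by blast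
qed

text \<open>Joint continuity of the quotient across x = 0 follows from Hadamard's formula, which
  writes it as the integral of f_x(tx, y) over 0 \<le> t \<le> 1. Keeping the radius
  \<open>S\<close> is essential for the later iteration.\<close>

lemma sep_holo_divide_fst:
  assumes f: "sep_holo S f" and f0: "\<And>y. y \<in> ball 0 S \<Longrightarrow> f (0, y) = 0"
  obtains g where "sep_holo S g" "\<And>x y. x \<in> ball 0 S \<Longrightarrow> y \<in> ball 0 S \<Longrightarrow> f (x, y) = x * g (x, y)"
proof
  define fx where "fx = (\<lambda>x y. deriv (\<lambda>t. f (t, y)) x)"
  define g where "g = (\<lambda>(x, y). if x = 0 then fx 0 y else f (x, y) / x)"
  have S: "0 \<in> ball (0::complex) S" if "x \<in> ball (0::complex) S" for x
    using that norm_ge_zero[of x] by (simp del: norm_ge_zero)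
  show "f (x, y) = x * g (x, y)" if "x \<in> ball 0 S" "y \<in> ball 0 S" for x y
    using f0 that by (auto simp: g_def)
  have holx: "(\<lambda>x. f (x, y)) holomorphic_on ball 0 S" and holy: "(\<lambda>y. f (x, y)) holomorphic_on ball 0 S"
    if "y \<in> ball 0 S" "x \<in> ball 0 S" for x y
    using f that by (auto simp: sep_holo_def)
  have g_int: "g (x, y) = integral (cbox 0 1) (\<lambda>t. fx (of_real t * x) y)"
    if x: "x \<in> ball 0 S" and y: "y \<in> ball 0 S" for x y
  proof (cases "x = 0")
    case False
    have I: "((\<lambda>t. fx (of_real t * x) y * x) has_integral f (of_real 1 * x, y) - f (of_real 0 * x, y)) {0..1}"
    proof (rule fundamental_theorem_of_calculus)
      fix t :: real assume t: "t \<in> {0..1}"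
      have tx: "of_real t * x \<in> ball 0 S"
      proof -
        have "norm (of_real t * x) \<le> norm x" using t by (simp add: norm_mult mult_left_le_one_le)
        then show ?thesis using x by simp
      qed
      have d: "((\<lambda>x. f (x, y)) has_field_derivative fx (of_real t * x) y) (at (of_real t * x))"
        unfolding fx_def using holomorphic_derivI[OF holx[OF y x] open_ball tx] by simp
      show "((\<lambda>t. f (of_real t * x, y)) has_vector_derivative fx (of_real t * x) y * x) (at t within {0..1})"
        by (rule has_vector_derivative_at_within,
            rule field_vector_diff_chain_at[of "\<lambda>t. of_real t * x" _ _ "\<lambda>x. f (x, y)", OF _ d,
              unfolded o_def, THEN has_vector_derivative_eq_rhs])
          (auto intro!: derivative_eq_intros)
    qed simp
    have "integral {0..1} (\<lambda>t. fx (of_real t * x) y * x) = f (x, y)"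
      by (subst integral_unique[OF I]) (use f0[OF y] in simp)
    then show ?thesis using False by (simp add: g_def field_simps)
  qed (simp add: g_def)
  show "sep_holo S g"
    unfolding sep_holo_def
  proof (intro conjI ballI)
    show "continuous_on (ball 0 S \<times> ball 0 S) g"
    proof (rule continuous_on_ball_UN)
      fix R assume R: "0 < R" "R < S"
      have shrink: "t * cmod w < R" if "0 \<le> t" "t \<le> 1" "cmod w < R" for t w
        using mult_left_le_one_le[of "cmod w" t] that by simp
      have cf: "continuous_on (ball 0 R \<times> ball 0 R) (\<lambda>z. fx (fst z) (snd z))"
        unfolding fx_def
        by (rule continuous_on_subset[OF continuous_deriv_fst[OF f R, unfolded split_beta]])
          (use R in auto)
      have "continuous_on (ball 0 R \<times> ball 0 R)
          (\<lambda>z. integral (cbox 0 1) (\<lambda>t. fx (of_real t * fst z) (snd z)))"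
      proof (rule integral_continuous_on_param, unfold split_beta)
        show "continuous_on ((ball 0 R \<times> ball 0 R) \<times> cbox 0 (1::real))
            (\<lambda>p. fx (of_real (snd p) * fst (fst p)) (snd (fst p)))"
          by (rule continuous_on_compose2[OF cf, of _ "\<lambda>p. (of_real (snd p) * fst (fst p), snd (fst p))",
                unfolded fst_conv snd_conv])
            (auto intro!: continuous_intros simp: norm_mult intro!: shrink)
      qed
      then show "continuous_on (ball 0 R \<times> ball 0 R) g"
        by (rule continuous_on_eq) (use R in \<open>auto simp: g_int\<close>)
    qed
  next
    fix y :: complex assume y: "y \<in> ball 0 S"
    have "(\<lambda>x. if x = 0 then deriv (\<lambda>t. f (t, y)) 0 else (f (x, y) - f (0, y)) / (x - 0)) holomorphic_on ball 0 S"
      by (rule pole_lemma_open) (use holx[OF y y] in auto)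
    then show "(\<lambda>x. g (x, y)) holomorphic_on ball 0 S"
      using f0[OF y] by (simp add: g_def fx_def cong: if_cong)
  next
    fix x :: complex assume x: "x \<in> ball 0 S"
    show "(\<lambda>y. g (x, y)) holomorphic_on ball 0 S"
    proof (cases "x = 0")
      case True
      have "fx 0 field_differentiable at y" if y: "y \<in> ball 0 S" for y
      proof -
        define R where "R = (norm y + S) / 2"
        have R: "0 < R" "R < S" "y \<in> ball 0 R"
          using y norm_ge_zero[of y] unfolding R_def by (auto simp del: norm_ge_zero)
        then have "fx 0 holomorphic_on ball 0 R"
          using sep_holo_deriv_fst[OF f R(1,2)] by (auto simp: sep_holo_def fx_def)
        then show ?thesis using R(3) holomorphic_on_imp_differentiable_at open_ball by blast
      qed
      then show ?thesis using True
        by (auto simp: g_def holomorphic_on_def intro: field_differentiable_at_within)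
    qed (use holy[OF x x] in \<open>auto simp: g_def intro!: holomorphic_intros\<close>)
  qed
qed

text \<open>A nonzero F with F(0) = 0 has a finite order n at 0, which contradicts divisibility by
  the power n + 1 of x.\<close>

lemma holomorphic_infinite_order_zero:
  assumes "F holomorphic_on ball 0 d"
    and "\<And>n. \<exists>G. G holomorphic_on ball 0 d \<and> (\<forall>x\<in>ball 0 d. F x = x ^ n * G x)"
    and x: "x \<in> ball (0::complex) d"
  shows "F x = 0"
proof (rule ccontr)
  assume nz: "F x \<noteq> 0"
  have d: "0 < d" using x norm_ge_zero[of x] by (simp del: norm_ge_zero)
  obtain G1 where "\<forall>x\<in>ball 0 d. F x = x ^ 1 * G1 x" using assms(2)[of 1] by blast
  then have F0: "F 0 = 0" using d by simp
  have nonconst: "\<not> F constant_on ball 0 d"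
  proof
    assume "F constant_on ball 0 d"
    then have "F x = F 0" unfolding constant_on_def using x d by auto
    then show False using nz F0 by simp
  qed
  have "0 \<in> ball (0::complex) d" using d by simp
  then obtain g r n where g: "0 < r" "ball (0::complex) r \<subseteq> ball 0 d" "g holomorphic_on ball 0 r"
    "\<And>w. w \<in> ball 0 r \<Longrightarrow> F w = (w - 0) ^ n * g w" "\<And>w. w \<in> ball 0 r \<Longrightarrow> g w \<noteq> 0"
    by (rule holomorphic_factor_zero_nonconstant[OF assms(1) open_ball connected_ball _ F0 nonconst])
      blast
  obtain G where G: "G holomorphic_on ball 0 d" "\<forall>x\<in>ball 0 d. F x = x ^ Suc n * G x"
    using assms(2)[of "Suc n"] by blast
  \<comment> \<open>The factor \<open>w ^ n\<close> cancels only for w \<noteq> 0, so g(0) = 0 is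
    reached as a limit.\<close>
  have ev: "g w = w * G w" if "w \<in> ball 0 r - {0}" for w
  proof -
    have "w \<in> ball 0 d" using g(2) that by blast
    then have "F w = w ^ Suc n * G w" using G(2) by blast
    moreover have "F w = w ^ n * g w" using g(4)[of w] that by simp
    ultimately have "w ^ n * g w = w ^ n * (w * G w)" by (simp add: mult_ac)
    then show ?thesis using that by simp
  qed
  have g0: "(g \<longlongrightarrow> g 0) (at 0)" and G0: "(G \<longlongrightarrow> G 0) (at 0)"
    using g(1,3) G(1) d holomorphic_on_imp_continuous_on[of g "ball 0 r"]
      holomorphic_on_imp_continuous_on[of G "ball 0 d"]
    by (auto simp: continuous_on_eq_continuous_at isCont_def)
  have "\<forall>\<^sub>F w in at 0. w * G w = g w"
    unfolding eventually_at_topological using g(1)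
    by (intro exI[of _ "ball 0 r"]) (auto simp: ev)
  then have "(g \<longlongrightarrow> 0 * G 0) (at 0)"
    by (rule Lim_transform_eventually[OF tendsto_mult[OF tendsto_ident_at G0]])
  then have "g 0 = 0 * G 0" by (rule LIM_unique[OF g0])
  then show False using g(1,5) by simp
qed

text \<open>The Cauchy integral in the second variable. It needs \<open>k\<close> only on the circle
  of radius \<open>R\<close>, so a quotient with poles inside is allowed.\<close>

definition cauchy_transform ::
    "real \<Rightarrow> (complex \<times> complex \<Rightarrow> complex) \<Rightarrow> complex \<times> complex \<Rightarrow> complex" where
  "cauchy_transform R k = (\<lambda>(x, y). contour_integral (circlepath 0 R) (\<lambda>w. k (x, w) / (w - y))
     / (2 * of_real pi * \<i>))"

text \<open>Differentiation under the integral sign in either variable; \<open>d \<le> R\<close>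
  keeps y off the circle. The x-derivative \<open>kx\<close> is passed in explicitly since its
  continuity is what the Leibniz rule requires.\<close>

lemma sep_holo_cauchy_transform:
  assumes d: "0 < d" "d \<le> R"
    and k: "continuous_on (ball 0 d \<times> sphere 0 R) k"
    and kx: "continuous_on (ball 0 d \<times> sphere 0 R) kx"
    and D: "\<And>x w. x \<in> ball 0 d \<Longrightarrow> w \<in> sphere 0 R \<Longrightarrow>
      ((\<lambda>x. k (x, w)) has_field_derivative kx (x, w)) (at x)"
  shows "sep_holo d (cauchy_transform R k)"
proof -
  define c where "c = circlepath 0 R"
  define e where "e = (\<lambda>s::real. 2 * pi * \<i> * R * exp (2 * of_real pi * \<i> * s))"
  have cR: "c s \<in> sphere 0 R" for s
    using d by (simp add: c_def circlepath norm_mult)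
  have ne: "c s - y \<noteq> 0" if "y \<in> ball 0 d" for s y
    using cR[of s] that d by auto
  have eq: "cauchy_transform R k = (\<lambda>z. integral (cbox 0 1)
      (\<lambda>s. k (fst z, c s) / (c s - snd z) * e s) / (2 * of_real pi * \<i>))"
    by (simp add: cauchy_transform_def contour_integral_integral c_def e_def
        vector_derivative_circlepath split_beta fun_eq_iff)
  have e: "continuous_on A (\<lambda>z. e (g z))" if "continuous_on A g" for A and g :: "_ \<Rightarrow> real"
    unfolding e_def by (intro continuous_intros that)
  have c: "continuous_on A (\<lambda>z. c (g z))" if "continuous_on A g" for A and g :: "_ \<Rightarrow> real"
    unfolding c_def by (intro continuous_intros that)
  note ci = continuous_intros e c continuous_on_compose2[OF k] continuous_on_compose2[OF kx]
  show ?thesis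
    unfolding sep_holo_def eq fst_conv snd_conv
  proof (intro conjI ballI holomorphic_on_divide holomorphic_on_const continuous_on_divide
      continuous_on_const)
    show "continuous_on (ball 0 d \<times> ball 0 d)
        (\<lambda>z. integral (cbox 0 1) (\<lambda>s. k (fst z, c s) / (c s - snd z) * e s))"
      by (rule integral_continuous_on_param, unfold split_beta)
        (intro ci, use cR ne in auto)
  next
    fix y :: complex assume y: "y \<in> ball 0 d"
    show "(\<lambda>x. integral (cbox 0 1) (\<lambda>s. k (x, c s) / (c s - y) * e s)) holomorphic_on ball 0 d"
    proof (rule leibniz_rule_holomorphic[where fx = "\<lambda>x s. kx (x, c s) / (c s - y) * e s"])
      show "((\<lambda>x. k (x, c s) / (c s - y) * e s) has_field_derivative kx (x, c s) / (c s - y) * e s)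
          (at x within ball 0 d)" if "x \<in> ball 0 d" for x s
        by (intro DERIV_cmult_right DERIV_cdivide has_field_derivative_at_within[OF D[OF that cR]])
      show "(\<lambda>s. k (x, c s) / (c s - y) * e s) integrable_on cbox 0 1" if "x \<in> ball 0 d" for x
        by (rule integrable_continuous, intro ci) (use cR ne y that in auto)
      show "continuous_on (ball 0 d \<times> cbox 0 1) (\<lambda>(x, s). kx (x, c s) / (c s - y) * e s)"
        unfolding split_beta by (intro ci) (use cR ne y in auto)
    qed (rule convex_ball)
  next
    fix x :: complex assume x: "x \<in> ball 0 d"
    show "(\<lambda>y. integral (cbox 0 1) (\<lambda>s. k (x, c s) / (c s - y) * e s)) holomorphic_on ball 0 d"
    proof (rule leibniz_rule_holomorphic[where fx = "\<lambda>y s. k (x, c s) / (c s - y)\<^sup>2 * e s"])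
      show "((\<lambda>y. k (x, c s) / (c s - y) * e s) has_field_derivative k (x, c s) / (c s - y)\<^sup>2 * e s)
          (at y within ball 0 d)" if "y \<in> ball 0 d" for y s
        using ne[OF that, of s] by (auto intro!: derivative_eq_intros simp: power2_eq_square)
      show "(\<lambda>s. k (x, c s) / (c s - y) * e s) integrable_on cbox 0 1" if "y \<in> ball 0 d" for y
        by (rule integrable_continuous, intro ci) (use cR ne that x in auto)
      show "continuous_on (ball 0 d \<times> cbox 0 1) (\<lambda>(y, s). k (x, c s) / (c s - y)\<^sup>2 * e s)"
        unfolding split_beta by (intro ci) (use cR ne x in auto)
    qed (rule convex_ball)
  qed auto
qed

section \<open>Germs restricted to the line \<open>x = 0\<close>\<close>

lemma germ_rep:
  obtains f S where "0 < S" "sep_holo S f" "g = abs_germ f"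
proof (induct g rule: germ.abs_induct)
  case (1 f)
  then have "holomorphic_near_0 f" by (simp add: germ_eq_def)
  then show ?case using 1 unfolding holomorphic_near_0_iff_sep_holo by blast
qed

lemma germ_eqI_sep_holo: "0 < S \<Longrightarrow> sep_holo S f \<Longrightarrow> germ_eq f f"
  unfolding germ_eq_def using holomorphic_near_0_iff_sep_holo by auto

lemma abs_germ_eq_iff:
  assumes "0 < S" "sep_holo S f" "sep_holo S g"
  shows "abs_germ f = abs_germ g \<longleftrightarrow> (\<exists>r>0. \<forall>x\<in>ball 0 r. \<forall>y\<in>ball 0 r. f (x, y) = g (x, y))"
  using assms germ_eqI_sep_holo[of S] Quotient_rel[OF Quotient_germ, of f g]
  by (simp add: germ_eq_def nhds_0_polydisc_iff)

lift_definition germ_x :: germ is fst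
  by (simp add: germ_eqI_sep_holo[OF zero_less_one sep_holo_fst])

lemma abs_germ_arith:
  assumes "0 < S" "sep_holo S f" "sep_holo S g"
  shows "abs_germ (\<lambda>z. f z * g z) = abs_germ f * abs_germ g"
    and "abs_germ (\<lambda>z. f z - g z) = abs_germ f - abs_germ g"
  using assms germ_eqI_sep_holo[of S]
  by (simp_all add: times_germ.abs_eq minus_germ.abs_eq)

text \<open>Dividing by x costs no more than a removable singularity, so the ring modulo x is the
  ring of one-variable germs in y, where zeros have an order.\<close>

lemma germ_x_dvd_iff:
  assumes S: "0 < S" "sep_holo S f"
  shows "germ_x dvd abs_germ f \<longleftrightarrow> (\<exists>r>0. \<forall>y\<in>ball 0 r. f (0, y) = 0)"
proof
  assume "germ_x dvd abs_germ f"
  then obtain k where k: "abs_germ f = germ_x * k" by (auto elim: dvdE)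
  obtain K T where T: "0 < T" "sep_holo T K" "k = abs_germ K" by (rule germ_rep)
  define R where "R = min S T"
  have R: "0 < R" "sep_holo R f" "sep_holo R K"
    using S T sep_holo_subset by (auto simp: R_def intro: sep_holo_subset)
  have "abs_germ f = abs_germ (\<lambda>z. fst z * K z)"
    unfolding k T germ_x.abs_eq using R by (simp add: abs_germ_arith sep_holo_fst germ_x_def)
  then obtain r where "r > 0" "\<forall>x\<in>ball 0 r. \<forall>y\<in>ball 0 r. f (x, y) = x * K (x, y)"
    using abs_germ_eq_iff[OF R(1,2) sep_holo_mult[OF sep_holo_fst R(3)]] by auto
  then show "\<exists>r>0. \<forall>y\<in>ball 0 r. f (0, y) = 0" by (intro exI[of _ r]) auto
next
  assume "\<exists>r>0. \<forall>y\<in>ball 0 r. f (0, y) = 0"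
  then obtain r where r: "r > 0" "\<forall>y\<in>ball 0 r. f (0, y) = 0" by blast
  define R where "R = min S r"
  have R: "0 < R" "sep_holo R f"
    using S r by (auto simp: R_def intro: sep_holo_subset)
  have "f (0, y) = 0" if "y \<in> ball 0 R" for y
    using r that by (auto simp: R_def)
  then obtain g where g: "sep_holo R g" "\<And>x y. x \<in> ball 0 R \<Longrightarrow> y \<in> ball 0 R \<Longrightarrow> f (x, y) = x * g (x, y)"
    using sep_holo_divide_fst[OF R(2)] by blast
  have "abs_germ f = abs_germ (\<lambda>z. fst z * g z)"
    using abs_germ_eq_iff[OF R sep_holo_mult[OF sep_holo_fst g(1)]] R(1) g(2) by auto
  then show "germ_x dvd abs_germ f"
    using abs_germ_arith(1)[OF R(1) sep_holo_fst g(1)] by (simp add: germ_x_def)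
qed

section \<open>Units and the order of vanishing on x = 0\<close>

lift_definition germ_y :: germ is snd
  by (rule germ_eqI_sep_holo[OF zero_less_one])
    (use sep_holo_snd_comp[of "\<lambda>y. y" 1] in simp)

lemma germ_value_simps [simp]:
  "germ_value (a * b) = germ_value a * germ_value b" "germ_value (a + b) = germ_value a + germ_value b"
  "germ_value (a - b) = germ_value a - germ_value b" "germ_value 0 = 0" "germ_value 1 = 1"
  "germ_value germ_x = 0" "germ_value germ_y = 0" "germ_value (germ_const c) = c"
  by (transfer, simp)+

lemma germ_value_power [simp]: "germ_value (a ^ n) = germ_value a ^ n"
  by (induction n) simp_all

text \<open>The ring of germs is local: near 0 the reciprocal of a function with nonzero value is
  again holomorphic.\<close>

lemma germ_unit_iff: "u dvd 1 \<longleftrightarrow> germ_value u \<noteq> 0"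
proof
  assume "u dvd 1"
  then obtain k where "1 = u * k" by (auto elim: dvdE)
  then have "germ_value u * germ_value k = 1" by (metis germ_value_simps(1,5))
  then show "germ_value u \<noteq> 0" by auto
next
  assume nz: "germ_value u \<noteq> 0"
  obtain f S where f: "0 < S" "sep_holo S f" "u = abs_germ f" by (rule germ_rep)
  have f0: "f 0 \<noteq> 0"
    using nz germ_eqI_sep_holo[OF f(1,2)] f(3) by (simp add: germ_value.abs_eq)
  have "isCont f 0"
    using osgood[OF f(2), of 0 0] f(1) cdiff2_at_imp_isCont by (simp add: zero_prod_def)
  then have "(f \<longlongrightarrow> f 0) (nhds 0)"
    using tendsto_at_iff_tendsto_nhds[of f 0] by (simp add: isCont_def)
  then have "\<forall>\<^sub>F z in nhds 0. f z \<noteq> 0"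
    by (rule tendsto_imp_eventually_ne) (rule f0)
  then obtain r where r: "r > 0" "\<forall>x\<in>ball 0 r. \<forall>y\<in>ball 0 r. f (x, y) \<noteq> 0"
    unfolding nhds_0_polydisc_iff by blast
  define R where "R = min r S"
  have R: "0 < R" "sep_holo R f" using r f by (auto simp: R_def intro: sep_holo_subset)
  have nz': "f z \<noteq> 0" if "z \<in> ball 0 R \<times> ball 0 R" for z
    using r(2) that by (cases z) (auto simp: R_def)
  have inv: "sep_holo R (\<lambda>z. inverse (f z))" by (rule sep_holo_inverse[OF R(2) nz'])
  have "u * abs_germ (\<lambda>z. inverse (f z)) = abs_germ (\<lambda>z. f z * inverse (f z))"
    by (simp add: f(3) abs_germ_arith(1)[OF R inv])
  also have "\<dots> = abs_germ (\<lambda>_. 1)"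
    using abs_germ_eq_iff[OF R(1) sep_holo_mult[OF R(2) inv], of "\<lambda>_. 1"] nz' R(1)
      sep_holo_snd_comp[of "\<lambda>_. 1" R] by auto
  also have "\<dots> = 1" by (simp add: one_germ_def)
  finally show "u dvd 1" by (metis dvd_triv_left)
qed

lemma sep_holo_snd_power: "sep_holo S (\<lambda>z. snd z ^ n)"
  by (rule sep_holo_snd_comp) (intro holomorphic_intros)

lemma germ_y_power: "germ_y ^ n = abs_germ (\<lambda>z. snd z ^ n)"
proof (induction n)
  case (Suc n)
  have "sep_holo 1 (\<lambda>z. snd z)" using sep_holo_snd_power[of 1 1] by simp
  then show ?case
    using abs_germ_arith(1)[of 1 "\<lambda>z. snd z" "\<lambda>z. snd z ^ n"] sep_holo_snd_power Suc by (simp add: germ_y_def)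
qed (simp add: one_germ_def)

lemma not_germ_x_dvd_germ_y_power: "\<not> germ_x dvd germ_y ^ n"
proof
  assume "germ_x dvd germ_y ^ n"
  then obtain r where r: "r > 0" "\<forall>y\<in>ball (0::complex) r. y ^ n = 0"
    using germ_x_dvd_iff[OF zero_less_one sep_holo_snd_power] by (auto simp: germ_y_power)
  then have "(of_real (r / 2) :: complex) ^ n = 0" by (intro r(2)[rule_format]) auto
  then show False using r(1) by simp
qed

text \<open>A zero of h(0, y) at the origin is isolated, so a power of y splits off. Thus m is the
  order of h on x = 0, and the ring modulo x is a discrete valuation ring with uniformizer
  y.\<close>

lemma germ_decompose:
  assumes "\<not> germ_x dvd h"
  obtains m u where "u dvd 1" "germ_x dvd h - germ_y ^ m * u"
proof (cases "germ_value h = 0")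
  case False
  then show thesis using that[of h 0] by (simp add: germ_unit_iff)
next
  case True
  obtain H S where H: "0 < S" "sep_holo S H" "h = abs_germ H" by (rule germ_rep)
  have H0: "H (0, 0) = 0"
    using True germ_eqI_sep_holo[OF H(1,2)] H(3) by (simp add: germ_value.abs_eq zero_prod_def)
  have hol: "(\<lambda>y. H (0, y)) holomorphic_on ball 0 S" using H by (auto simp: sep_holo_def)
  have "\<not> (\<lambda>y. H (0, y)) constant_on ball 0 S"
  proof
    assume c: "(\<lambda>y. H (0, y)) constant_on ball 0 S"
    have "H (0, y) = 0" if "y \<in> ball 0 S" for y
      using c that H(1) H0 unfolding constant_on_def by (metis centre_in_ball)
    then show False using assms H(1) unfolding H(3) germ_x_dvd_iff[OF H(1,2)] by blast
  qed
  moreover have "0 \<in> ball (0::complex) S" using H(1) by simp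
  ultimately obtain g r n where g: "0 < r" "ball (0::complex) r \<subseteq> ball 0 S" "g holomorphic_on ball 0 r"
    "\<And>w. w \<in> ball 0 r \<Longrightarrow> H (0, w) = (w - 0) ^ n * g w" "\<And>w. w \<in> ball 0 r \<Longrightarrow> g w \<noteq> 0"
    by (rule_tac holomorphic_factor_zero_nonconstant[OF hol open_ball connected_ball _ H0]) blast+
  have "r \<le> S" using g(1,2) by (simp add: ball_subset_ball_iff)
  then have s: "sep_holo r (\<lambda>z. g (snd z))" "sep_holo r (\<lambda>z. snd z ^ n)" "sep_holo r H"
    by (rule_tac [3] sep_holo_subset[OF H(2)]) (auto intro: sep_holo_snd_power sep_holo_snd_comp g(3))
  have "abs_germ (\<lambda>z. H z - snd z ^ n * g (snd z)) = h - germ_y ^ n * abs_germ (\<lambda>z. g (snd z))"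
    by (simp add: abs_germ_arith[OF g(1)] s sep_holo_mult H(3) germ_y_power)
  moreover have "germ_x dvd abs_germ (\<lambda>z. H z - snd z ^ n * g (snd z))"
    using germ_x_dvd_iff[OF g(1) sep_holo_diff[OF s(3) sep_holo_mult[OF s(2,1)]]] g(1,4) by auto
  moreover have "germ_value (abs_germ (\<lambda>z. g (snd z))) \<noteq> 0"
    using germ_eqI_sep_holo[OF g(1) s(1)] g(1,5) by (simp add: germ_value.abs_eq)
  ultimately show thesis
    using that by (simp add: germ_unit_iff)
qed

text \<open>Primality of x: orders on x = 0 add, and a unit times a power of y does not vanish
  there.\<close>

lemma not_germ_x_dvd_mult:
  assumes "\<not> germ_x dvd a" "\<not> germ_x dvd b"
  shows "\<not> germ_x dvd a * b"
proof
  assume ab: "germ_x dvd a * b"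
  obtain i u where u: "u dvd 1" "germ_x dvd a - germ_y ^ i * u" by (rule germ_decompose[OF assms(1)])
  obtain j v where v: "v dvd 1" "germ_x dvd b - germ_y ^ j * v" by (rule germ_decompose[OF assms(2)])
  have "a * b - germ_y ^ (i + j) * (u * v) =
      (a - germ_y ^ i * u) * b + germ_y ^ i * u * (b - germ_y ^ j * v)"
    by (simp add: algebra_simps power_add)
  then have "germ_x dvd a * b - germ_y ^ (i + j) * (u * v)"
    using u v by simp
  then have "germ_x dvd germ_y ^ (i + j) * (u * v)" using ab by (metis dvd_diff_right_iff)
  moreover have "u * v dvd 1" using u v by (simp add: germ_unit_iff)
  ultimately show False using not_germ_x_dvd_germ_y_power by (metis dvd_mult_unit_iff)
qed

lemma germ_x_not_zero: "germ_x \<noteq> 0"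
proof
  have c: "sep_holo 1 (\<lambda>_. 0)" by (rule sep_holo_snd_comp) (rule holomorphic_on_const)
  assume "germ_x = 0"
  then obtain r where r: "r > 0" "\<forall>x\<in>ball (0::complex) r. \<forall>y\<in>ball (0::complex) r. x = 0"
    using abs_germ_eq_iff[OF zero_less_one sep_holo_fst c] by (auto simp: germ_x_def zero_germ_def)
  then have "(of_real (r / 2) :: complex) = 0" by (intro r(2)[rule_format, of _ 0]) auto
  then show False using r(1) by simp
qed

text \<open>Peels off one Taylor coefficient; iterated in y it produces the spanning monomials of
  \<open>finite_span_regular\<close>.\<close>

lemma germ_split:
  obtains c s k where "h = germ_const c + germ_y * s + germ_x * k"
proof (cases "germ_x dvd h - germ_const (germ_value h)")
  case True
  then obtain k where "h - germ_const (germ_value h) = germ_x * k" by (auto elim: dvdE)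
  then have "h = germ_const (germ_value h) + germ_y * 0 + germ_x * k" by (simp add: algebra_simps)
  then show thesis by (rule that)
next
  case False
  then obtain m u where u: "u dvd 1" "germ_x dvd h - germ_const (germ_value h) - germ_y ^ m * u"
    by (rule germ_decompose)
  then obtain k where k: "h - germ_const (germ_value h) - germ_y ^ m * u = germ_x * k" by (auto elim: dvdE)
  \<comment> \<open>The product vanishes at the origin while u does not, so m is positive and one
    factor y can be pulled out.\<close>
  have "germ_value (germ_y ^ m * u) = 0"
    using arg_cong[OF k, of germ_value] by simp
  then obtain n where "m = Suc n" using u(1) by (cases m) (auto simp: germ_unit_iff)
  then have "h = germ_const (germ_value h) + germ_y * (germ_y ^ n * u) + germ_x * k"
    using k by (simp add: algebra_simps)
  then show thesis by (rule that)
qed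

section \<open>Ideals saturated with respect to \<open>x\<close>\<close>

text \<open>This replaces Weierstrass division: an ideal \<open>I\<close> with \<open>I = p \<O>\<^sub>2 + x I\<close> is generated by \<open>p\<close>,
  although \<open>I\<close> is not known to be finitely generated and Nakayama's lemma does not apply.\<close>

lemma saturated_imp_dvd:
  fixes p :: germ
  assumes np: "\<not> germ_x dvd p"
    and a: "\<And>h. h \<in> I \<Longrightarrow> \<exists>q. germ_x dvd h - q * p"
    and b: "\<And>h q k. h \<in> I \<Longrightarrow> h - q * p = germ_x * k \<Longrightarrow> k \<in> I"
    and h: "h \<in> I"
  shows "p dvd h"
proof -
  obtain P T where T: "0 < T" "sep_holo T P" "p = abs_germ P" by (rule germ_rep)
  obtain H U where U: "0 < U" "sep_holo U H" "h = abs_germ H" by (rule germ_rep)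
  obtain z where z: "z \<in> ball 0 T" "P (0, z) \<noteq> 0"
    using np unfolding T(3) germ_x_dvd_iff[OF T(1,2)] using T(1) by blast
  have "(\<lambda>y. P (0, y)) holomorphic_on ball 0 T"
    using T(1,2) by (auto simp: sep_holo_def)
  then have "\<forall>\<^sub>F y in at 0. P (0, y) \<noteq> 0 \<and> y \<in> ball 0 T"
    by (rule non_zero_neighbour_alt[OF _ open_ball connected_ball]) (use z T in auto)
  then obtain V where V: "V > 0" "\<And>y. y \<noteq> 0 \<Longrightarrow> norm y < V \<Longrightarrow> P (0, y) \<noteq> 0"
    unfolding eventually_at by auto
  define S where "S = min V (min T U)"
  have S: "0 < S" and sP: "sep_holo S P" and sH: "sep_holo S H"
    using T U V sep_holo_subset[OF T(2), of S] sep_holo_subset[OF U(2), of S] by (auto simp: S_def)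
  have nz: "P (0, y) \<noteq> 0" if "y \<noteq> 0" "y \<in> ball 0 S" for y
    using V(2)[of y] that by (auto simp: S_def)
  text \<open>The quotient \<open>q(y) = H(0, y) / P(0, y)\<close> exists on the whole disc because \<open>P(0, y)\<close> vanishes
    only at \<open>0\<close>; hence the polydisc does not shrink when the step is iterated.\<close>
  have step: "\<exists>q H'. q holomorphic_on ball 0 S \<and> sep_holo S H' \<and> abs_germ H' \<in> I \<and>
      (\<forall>x\<in>ball 0 S. \<forall>y\<in>ball 0 S. H (x, y) = q y * P (x, y) + x * H' (x, y))"
    if sH: "sep_holo S H" and I: "abs_germ H \<in> I" for H
  proof -
    obtain q where q: "germ_x dvd abs_germ H - q * p" using a[OF I] by blast
    obtain Q W where W: "0 < W" "sep_holo W Q" "q = abs_germ Q" by (rule germ_rep)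
    define R where "R = min S W"
    have R: "0 < R" "R \<le> S" and sR: "sep_holo R H" "sep_holo R P" "sep_holo R Q"
      using S W sH sP sep_holo_subset by (auto simp: R_def intro: sep_holo_subset)
    have "germ_x dvd abs_germ (\<lambda>z. H z - Q z * P z)"
      using q unfolding W(3) T(3)
      by (simp add: abs_germ_arith[OF R(1)] sR sep_holo_mult)
    then obtain r0 where r0: "r0 > 0" "\<forall>y\<in>ball 0 r0. H (0, y) - Q (0, y) * P (0, y) = 0"
      using germ_x_dvd_iff[OF R(1) sep_holo_diff[OF sR(1) sep_holo_mult[OF sR(3,2)]]] by blast
    define r where "r = min r0 R"
    have r: "r > 0" "r \<le> R" "\<And>y. y \<in> ball 0 r \<Longrightarrow> H (0, y) = Q (0, y) * P (0, y)"
      using r0 R by (auto simp: r_def)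
    \<comment> \<open>Assumption \<open>a\<close> gives a quotient only near 0, on a radius not
      under control; elsewhere \<open>P (0, y)\<close> is invertible. Both formulas agree on the
      overlap.\<close>
    define q0 where "q0 = (\<lambda>y. if y \<in> ball 0 r then Q (0, y) else H (0, y) / P (0, y))"
    have q0: "H (0, y) = q0 y * P (0, y)" if "y \<in> ball 0 S" for y
      using r nz[of y] that by (cases "y = 0") (auto simp: q0_def)
    have "q0 holomorphic_on ball 0 r \<union> (ball 0 S - {0})"
    proof (rule holomorphic_on_Un)
      have "(\<lambda>y. Q (0, y)) holomorphic_on ball 0 r"
        using sep_holo_subset[OF sR(3) r(2)] r(1) by (auto simp: sep_holo_def)
      then show "q0 holomorphic_on ball 0 r"
        by (rule holomorphic_transform) (auto simp: q0_def)
      have "(\<lambda>y. H (0, y)) holomorphic_on ball 0 S - {0}" "(\<lambda>y. P (0, y)) holomorphic_on ball 0 S - {0}"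
        using sH sP S by (auto simp: sep_holo_def intro: holomorphic_on_subset)
      then have "(\<lambda>y. H (0, y) / P (0, y)) holomorphic_on ball 0 S - {0}"
        by (rule holomorphic_on_divide) (use nz in auto)
      then show "q0 holomorphic_on ball 0 S - {0}"
        by (rule holomorphic_transform) (use q0 nz in \<open>auto simp: field_simps\<close>)
    qed auto
    then have hol: "q0 holomorphic_on ball 0 S"
      by (rule holomorphic_on_subset) (use r in auto)
    have s: "sep_holo S (\<lambda>z. q0 (snd z) * P z)"
      by (intro sep_holo_mult sep_holo_snd_comp hol sP)
    have "H (0, y) - q0 y * P (0, y) = 0" if "y \<in> ball 0 S" for y
      using q0[OF that] by simp
    then obtain H' where H': "sep_holo S H'"
      "\<And>x y. x \<in> ball 0 S \<Longrightarrow> y \<in> ball 0 S \<Longrightarrow> H (x, y) - q0 y * P (x, y) = x * H' (x, y)"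
      using sep_holo_divide_fst[OF sep_holo_diff[OF sH s]] by auto
    have "abs_germ (\<lambda>z. H z - q0 (snd z) * P z) = abs_germ (\<lambda>z. fst z * H' z)"
      using abs_germ_eq_iff[OF S sep_holo_diff[OF sH s] sep_holo_mult[OF sep_holo_fst H'(1)]] S H'(2)
      by auto
    then have "abs_germ H - abs_germ (\<lambda>z. q0 (snd z)) * p = germ_x * abs_germ H'"
      by (simp add: abs_germ_arith[OF S] sH s hol sep_holo_snd_comp sP T(3) germ_x_def sep_holo_fst H'(1))
    then have "abs_germ H' \<in> I" by (rule b[OF I])
    then show ?thesis
      using hol H' by (intro exI[of _ q0] exI[of _ H']) (auto simp: algebra_simps)
  qed
  define R where "R = S / 2"
  have R: "0 < R" "R < S" using S by (auto simp: R_def)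
  \<comment> \<open>The zeros of \<open>P\<close> over the circle form a compact set whose
    projection to the x-axis misses 0, because P(0, w) \<noteq> 0 for |w| = R; a small disc in x
    avoids it.\<close>
  obtain d where d: "0 < d" "d \<le> R" and Pnz: "\<And>x w. x \<in> ball 0 d \<Longrightarrow> w \<in> sphere 0 R \<Longrightarrow> P (x, w) \<noteq> 0"
  proof -
    define Z where "Z = {z \<in> cball 0 R \<times> sphere 0 R. P z = 0}"
    have "continuous_on (cball 0 R \<times> sphere 0 R) P"
      using sP R by (auto simp: sep_holo_def elim!: continuous_on_subset)
    then have "closedin (top_of_set (cball 0 R \<times> sphere 0 R)) Z"
      unfolding Z_def by (rule continuous_closedin_preimage_constant)
    then have "compact Z"
      by (rule closedin_compact[rotated]) (intro compact_Times compact_cball compact_sphere)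
    then have "closed (fst ` Z)"
      by (intro compact_imp_closed compact_continuous_image continuous_intros)
    moreover have "0 \<notin> fst ` Z"
      using R nz by (fastforce simp: Z_def)
    ultimately obtain e where e: "e > 0" "ball 0 e \<subseteq> - fst ` Z"
      by (metis ComplI open_Compl open_contains_ball)
    show thesis
    proof (rule that[of "min e R"])
      fix x w assume x: "x \<in> ball (0::complex) (min e R)" and w: "w \<in> sphere (0::complex) R"
      then have "x \<notin> fst ` Z" using e(2) by auto
      then show "P (x, w) \<noteq> 0" using x w by (force simp: Z_def)
    qed (use e R in auto)
  qed
  text \<open>\<open>T H\<close> is the candidate for \<open>H / P\<close>. It reproduces functions of \<open>y\<close> alone, so the error \<open>E H\<close>
    satisfies \<open>E H = x * E H'\<close> whenever \<open>H = q(y) P + x H'\<close>; iterating, \<open>E H\<close> vanishes to infinite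
    order along \<open>x = 0\<close>.\<close>
  define T where "T = (\<lambda>H. cauchy_transform R (\<lambda>z. H z / P z))"
  define E where "E = (\<lambda>H z. H z - T H z * P z)"
  have dS: "d \<le> S" using d R by simp
  have cont: "continuous_on (ball 0 d \<times> sphere 0 R) F" if "sep_holo S F" for F
    using that d R by (auto simp: sep_holo_def elim!: continuous_on_subset)
  have sT: "sep_holo d (T H)" if H: "sep_holo S H" for H
    unfolding T_def
  proof (rule sep_holo_cauchy_transform[OF d,
        where kx = "\<lambda>(x, w). (deriv (\<lambda>t. H (t, w)) x * P (x, w) - H (x, w) * deriv (\<lambda>t. P (t, w)) x) / (P (x, w))\<^sup>2"])
    have cd: "continuous_on (ball 0 d \<times> sphere 0 R) (\<lambda>z. deriv (\<lambda>t. F (t, snd z)) (fst z))"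
      if "sep_holo S F" for F
      by (rule continuous_on_subset[OF continuous_deriv_fst[OF that R, unfolded split_beta]])
        (use d R in auto)
    show "continuous_on (ball 0 d \<times> sphere 0 R) (\<lambda>z. H z / P z)"
      using Pnz by (intro continuous_intros cont H sP) auto
    show "continuous_on (ball 0 d \<times> sphere 0 R) (\<lambda>(x, w). (deriv (\<lambda>t. H (t, w)) x * P (x, w) - H (x, w) * deriv (\<lambda>t. P (t, w)) x) / (P (x, w))\<^sup>2)"
      unfolding split_beta prod.collapse
      using Pnz by (intro continuous_intros cont cd H sP) auto
    fix x w assume x: "x \<in> ball (0::complex) d" and w: "w \<in> sphere (0::complex) R"
    have D: "((\<lambda>t. F (t, w)) has_field_derivative deriv (\<lambda>t. F (t, w)) x) (at x)" if "sep_holo S F" for F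
    proof -
      have "(\<lambda>t. F (t, w)) holomorphic_on ball 0 S" using that w R by (auto simp: sep_holo_def)
      then show ?thesis by (rule holomorphic_derivI) (use x dS in auto)
    qed
    show "((\<lambda>t. H (t, w) / P (t, w)) has_field_derivative
      (case (x, w) of (x, w) \<Rightarrow> (deriv (\<lambda>t. H (t, w)) x * P (x, w) - H (x, w) * deriv (\<lambda>t. P (t, w)) x) / (P (x, w))\<^sup>2)) (at x)"
      using DERIV_divide[OF D[OF H] D[OF sP] Pnz[OF x w]] by (simp add: power2_eq_square)
  qed
  have sE: "sep_holo d (E H)" if "sep_holo S H" for H
    unfolding E_def by (intro sep_holo_diff sep_holo_mult sT that sep_holo_subset[OF _ dS] sP)
  have E_step: "E H (x, y) = x * E H' (x, y)"
    if H: "sep_holo S H" "sep_holo S H'" and q: "q holomorphic_on ball 0 S"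
      and eq: "\<forall>x\<in>ball 0 S. \<forall>y\<in>ball 0 S. H (x, y) = q y * P (x, y) + x * H' (x, y)"
      and x: "x \<in> ball 0 d" and y: "y \<in> ball 0 d" for H H' q x y
  proof -
    let ?c = "circlepath 0 R"
    have ne: "w - y \<noteq> 0" if "w \<in> sphere 0 R" for w using that y d by auto
    have I: "(\<lambda>w. F w / (w - y)) contour_integrable_on ?c" if "continuous_on (sphere 0 R) F" for F
      by (rule contour_integrable_continuous_circlepath)
        (use R ne in \<open>auto intro!: continuous_intros that\<close>)
    have cq: "continuous_on (sphere 0 R) q"
      by (rule continuous_on_subset[OF holomorphic_on_imp_continuous_on[OF q]]) (use R in auto)
    have cH: "continuous_on (sphere 0 R) (\<lambda>w. F (x, w))" if "sep_holo S F" for F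
      by (rule continuous_on_compose2[OF cont[OF that]]) (use x in \<open>auto intro!: continuous_intros\<close>)
    have cHP: "continuous_on (sphere 0 R) (\<lambda>w. H' (x, w) / P (x, w))"
      using Pnz x by (intro continuous_intros cH H sP) auto
    have "contour_integral ?c (\<lambda>w. H (x, w) / P (x, w) / (w - y)) =
        contour_integral ?c (\<lambda>w. q w / (w - y) + x * (H' (x, w) / P (x, w) / (w - y)))"
    proof (rule contour_integral_eq)
      fix w assume "w \<in> path_image ?c"
      then have w: "w \<in> sphere 0 R" using R by simp
      then have "w \<in> ball 0 S" "x \<in> ball 0 S" using R x dS by auto
      then have "H (x, w) = q w * P (x, w) + x * H' (x, w)" using eq by blast
      then have "H (x, w) / P (x, w) = q w + x * (H' (x, w) / P (x, w))"
        using Pnz[OF x w] by (simp add: add_divide_distrib)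
      then show "H (x, w) / P (x, w) / (w - y) =
          q w / (w - y) + x * (H' (x, w) / P (x, w) / (w - y))"
        by (simp add: add_divide_distrib)
    qed
    also have "\<dots> = contour_integral ?c (\<lambda>w. q w / (w - y)) +
        x * contour_integral ?c (\<lambda>w. H' (x, w) / P (x, w) / (w - y))"
      by (subst contour_integral_add[OF I[OF cq] contour_integrable_lmul[OF I[OF cHP]]],
          subst contour_integral_lmul[OF I[OF cHP]]) (rule refl)
    also have "contour_integral ?c (\<lambda>w. q w / (w - y)) = 2 * of_real pi * \<i> * q y"
    proof (rule contour_integral_unique, rule Cauchy_integral_circlepath)
      show "continuous_on (cball 0 R) q"
        by (rule continuous_on_subset[OF holomorphic_on_imp_continuous_on[OF q]]) (use R in auto)
      show "q holomorphic_on ball 0 R" by (rule holomorphic_on_subset[OF q]) (use R in auto)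
    qed (use y d in auto)
    finally have "T H (x, y) = q y + x * T H' (x, y)"
      by (simp add: T_def cauchy_transform_def field_simps)
    then show ?thesis
      using eq x y dS by (simp add: E_def algebra_simps)
  qed
  have iter: "\<exists>H'. sep_holo S H' \<and> abs_germ H' \<in> I \<and>
      (\<forall>x\<in>ball 0 d. \<forall>y\<in>ball 0 d. E H (x, y) = x ^ n * E H' (x, y))" for n
  proof (induction n)
    case 0
    then show ?case using sH h U(3) by (intro exI[of _ H]) auto
  next
    case (Suc n)
    then obtain H1 where H1: "sep_holo S H1" "abs_germ H1 \<in> I"
      "\<forall>x\<in>ball 0 d. \<forall>y\<in>ball 0 d. E H (x, y) = x ^ n * E H1 (x, y)" by blast
    from step[OF H1(1,2)] obtain q H2 where H2: "q holomorphic_on ball 0 S" "sep_holo S H2" "abs_germ H2 \<in> I"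
      "\<forall>x\<in>ball 0 S. \<forall>y\<in>ball 0 S. H1 (x, y) = q y * P (x, y) + x * H2 (x, y)" by blast
    have "E H (x, y) = x ^ Suc n * E H2 (x, y)" if "x \<in> ball 0 d" "y \<in> ball 0 d" for x y
      using H1(3) E_step[OF H1(1) H2(2,1,4) that] that by simp
    then show ?case using H2 by blast
  qed
  have "E H (x, y) = 0" if x: "x \<in> ball 0 d" and y: "y \<in> ball 0 d" for x y
  proof (rule holomorphic_infinite_order_zero[where F = "\<lambda>x. E H (x, y)", OF _ _ x])
    show "(\<lambda>x. E H (x, y)) holomorphic_on ball 0 d"
      using sE[OF sH] y by (auto simp: sep_holo_def)
    fix n
    obtain H' where "sep_holo S H'" "\<forall>x\<in>ball 0 d. \<forall>y\<in>ball 0 d. E H (x, y) = x ^ n * E H' (x, y)"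
      using iter by blast
    then show "\<exists>G. G holomorphic_on ball 0 d \<and> (\<forall>x\<in>ball 0 d. E H (x, y) = x ^ n * G x)"
      using sE[of H'] y by (intro exI[of _ "\<lambda>x. E H' (x, y)"]) (auto simp: sep_holo_def)
  qed
  then have "abs_germ H = abs_germ (\<lambda>z. T H z * P z)"
    using abs_germ_eq_iff[OF d(1) sep_holo_subset[OF sH dS] sep_holo_mult[OF sT[OF sH] sep_holo_subset[OF sP dS]]]
      d(1) by (auto simp: E_def)
  also have "\<dots> = abs_germ (T H) * p"
    unfolding \<open>p = abs_germ P\<close> by (rule abs_germ_arith(1)[OF d(1) sT[OF sH] sep_holo_subset[OF sP dS]])
  finally show "p dvd h" unfolding U(3) by simp
qed

text \<open>A generator is any element of minimal \<open>y\<close>-order on \<open>x = 0\<close>.\<close>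

lemma saturated_ideal_principal:
  fixes f :: germ
  assumes add: "\<And>a b. a \<in> I \<Longrightarrow> b \<in> I \<Longrightarrow> a + b \<in> I"
    and mult: "\<And>a c. a \<in> I \<Longrightarrow> c * a \<in> I"
    and sat: "\<And>a. germ_x * a \<in> I \<Longrightarrow> a \<in> I"
    and f: "f \<in> I" "\<not> germ_x dvd f"
  obtains p where "p \<in> I" "\<And>h. h \<in> I \<Longrightarrow> p dvd h"
proof -
  define M where "M = {m. \<exists>p\<in>I. \<not> germ_x dvd p \<and> (\<exists>u. u dvd 1 \<and> germ_x dvd p - germ_y ^ m * u)}"
  obtain m0 u0 where "u0 dvd 1" "germ_x dvd f - germ_y ^ m0 * u0" by (rule germ_decompose[OF f(2)])
  then have "\<exists>m. m \<in> M" using f unfolding M_def by blast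
  then have m: "(LEAST m. m \<in> M) \<in> M" by (rule LeastI_ex)
  define m where "m = (LEAST m. m \<in> M)"
  obtain p u where p: "p \<in> I" "\<not> germ_x dvd p" "u dvd 1" "germ_x dvd p - germ_y ^ m * u"
    using m unfolding m_def[symmetric] by (auto simp: M_def)
  have diff: "a - c * b \<in> I" if "a \<in> I" "b \<in> I" for a b c
    using add[OF that(1) mult[OF that(2), of "- c"]] by simp
  obtain u' where u': "u * u' = 1" using p(3) by (metis dvdE)
  have red: "\<exists>q. germ_x dvd h - q * p" if h: "h \<in> I" for h
  proof (cases "germ_x dvd h")
    case True
    then show ?thesis by (intro exI[of _ 0]) simp
  next
    case False
    obtain j v where v: "v dvd 1" "germ_x dvd h - germ_y ^ j * v" by (rule germ_decompose[OF False])
    then have "j \<in> M" using h False by (auto simp: M_def)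
    then have "m \<le> j" unfolding m_def by (rule Least_le)
    \<comment> \<open>This multiple of \<open>p\<close> has the same leading part y^j v as
      \<open>h\<close>, since u u' = 1; on x = 0 the two cancel.\<close>
    then have "h - germ_y ^ (j - m) * v * u' * p =
        (h - germ_y ^ j * v) - germ_y ^ (j - m) * v * u' * (p - germ_y ^ m * u)"
      using u' by (simp add: algebra_simps power_add[symmetric])
    then show ?thesis using v p(4) by (metis dvd_diff dvd_mult)
  qed
  \<comment> \<open>If h - q p = x k with h and p in \<open>I\<close>, then x k lies in
    \<open>I\<close>, and saturation puts k there.\<close>
  have "p dvd h" if "h \<in> I" for h
    by (rule saturated_imp_dvd[OF p(2) red _ that]) (metis diff p(1) sat)+
  then show thesis using that p(1) by blast
qed

section \<open>Coprime germs form regular sequences\<close>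

lemma coprime_dvd_mult_cancel_regular:
  fixes f g h :: germ
  assumes cop: "coprime f g" and f: "\<not> germ_x dvd f" and dvd: "f dvd g * h"
  shows "f dvd h"
proof -
  text \<open>The ideal \<open>(f : g)\<close> has a generator \<open>p\<close>; then \<open>f / p\<close> divides both \<open>f\<close> and \<open>g\<close>.\<close>
  define I where "I = {h. f dvd g * h}"
  have f0: "f \<noteq> 0" using f by auto
  obtain p where p: "p \<in> I" "\<And>h. h \<in> I \<Longrightarrow> p dvd h"
  proof (rule saturated_ideal_principal[of I f])
    \<comment> \<open>Saturation of (f : g): x is prime and does not divide f, so it divides the
      cofactor and can be cancelled.\<close>
    fix a assume "germ_x * a \<in> I"
    then obtain k where k: "g * (germ_x * a) = f * k" by (auto simp: I_def elim: dvdE)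
    then have "germ_x dvd f * k" by (metis dvd_triv_left mult.left_commute)
    then obtain k' where "k = germ_x * k'" using not_germ_x_dvd_mult[OF f] by (metis dvdE)
    then have "germ_x * (g * a) = germ_x * (f * k')" using k by (simp add: ac_simps)
    then have "g * a = f * k'" using germ_x_not_zero by simp
    then show "a \<in> I" by (simp add: I_def)
  qed (use f in \<open>auto simp: I_def distrib_left mult.left_commute[of g]\<close>)
  have "f \<in> I" by (simp add: I_def)
  then obtain e where e: "f = p * e" using p(2) by (metis dvdE)
  obtain k where "g * p = f * k" using p(1) by (auto simp: I_def elim: dvdE)
  then have "p * g = p * (e * k)" using e by (simp add: ac_simps)
  then have "g = e * k" using f0 e by simp
  then have "e dvd 1" using cop e by (metis coprime_common_divisor dvd_triv_left dvd_triv_right)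
  then have "f dvd p" using e by simp
  moreover have "p dvd h" using dvd p(2) by (simp add: I_def)
  ultimately show ?thesis by (rule dvd_trans)
qed

lemma coprime_germ_x_power_regular:
  fixes f g :: germ
  assumes cop: "coprime f g" and f: "\<not> germ_x dvd f"
  obtains n a b where "germ_x ^ n = a * f + b * g"
proof -
  text \<open>The generator of the \<open>x\<close>-saturation of \<open>(f, g)\<close> is a common divisor of \<open>f\<close> and \<open>g\<close>.\<close>
  define I where "I = {h. \<exists>n a b. germ_x ^ n * h = a * f + b * g}"
  obtain p where p: "p \<in> I" "\<And>h. h \<in> I \<Longrightarrow> p dvd h"
  proof (rule saturated_ideal_principal[of I f])
    fix h k assume "h \<in> I" "k \<in> I"
    then obtain n a b m c d where "germ_x ^ n * h = a * f + b * g" "germ_x ^ m * k = c * f + d * g"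
      by (auto simp: I_def)
    moreover have "germ_x ^ (n + m) * (h + k) =
        germ_x ^ m * (germ_x ^ n * h) + germ_x ^ n * (germ_x ^ m * k)"
      by (simp add: algebra_simps power_add)
    ultimately have "germ_x ^ (n + m) * (h + k) =
        (germ_x ^ m * a + germ_x ^ n * c) * f + (germ_x ^ m * b + germ_x ^ n * d) * g"
      by (simp add: algebra_simps)
    then show "h + k \<in> I" by (auto simp: I_def)
  next
    fix h c assume "h \<in> I"
    then obtain n a b where "germ_x ^ n * h = a * f + b * g" by (auto simp: I_def)
    then have "germ_x ^ n * (c * h) = (c * a) * f + (c * b) * g"
      by (simp add: algebra_simps)
    then show "c * h \<in> I" by (auto simp: I_def)
  next
    fix a assume "germ_x * a \<in> I"
    then show "a \<in> I" by (auto simp: I_def mult.assoc[symmetric] power_Suc2[symmetric] simp del: power_Suc)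
  next
    have "germ_x ^ 0 * f = 1 * f + 0 * g" by simp
    then show "f \<in> I" unfolding I_def by blast
  qed (use f in auto)
  have "germ_x ^ 0 * f = 1 * f + 0 * g" "germ_x ^ 0 * g = 0 * f + 1 * g" by simp_all
  then have "f \<in> I" "g \<in> I" unfolding I_def by blast+
  then have "p dvd 1" using p(2) cop by (metis coprime_common_divisor)
  then obtain p' where "p * p' = 1" by (metis dvdE)
  moreover obtain n a b where "germ_x ^ n * p = a * f + b * g" using p(1) by (auto simp: I_def)
  ultimately have "germ_x ^ n = (p' * a) * f + (p' * b) * g"
    by (metis (no_types, lifting) distrib_left mult.assoc mult.commute mult.right_neutral)
  then show thesis by (rule that)
qed

section \<open>Finite colength\<close>

lemma span_mult_image:
  assumes "b \<in> germ_vec.span B"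
  shows "c * b \<in> germ_vec.span ((*) c ` B)"
  using assms
proof (induction rule: germ_vec.span_induct_alt)
  case (step k x y)
  have "c * (germ_scale k x + y) = germ_scale k (c * x) + c * y"
    by (simp add: germ_scale_def algebra_simps)
  moreover have "germ_scale k (c * x) + c * y \<in> germ_vec.span ((*) c ` B)"
    by (rule germ_vec.span_add[OF germ_vec.span_scale[OF germ_vec.span_base]]) (use step in auto)
  ultimately show ?case by simp
qed (simp add: germ_vec.span_zero)

text \<open>Generation without independence: it survives enlarging \<open>J\<close> and shearing,
  and suffices to bound dimensions.\<close>

definition spans_modulo :: "germ set \<Rightarrow> germ set \<Rightarrow> bool" where
  "spans_modulo B J \<longleftrightarrow> (\<forall>h. \<exists>b\<in>germ_vec.span B. h - b \<in> J)"

lemma spans_modulo_mono: "spans_modulo B J \<Longrightarrow> J \<subseteq> J' \<Longrightarrow> spans_modulo B J'"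
  unfolding spans_modulo_def by (meson subsetD)

lemma ideal_generated_insert_iff:
  "h \<in> ideal_generated (insert a A) \<longleftrightarrow> (\<exists>k. h - k * a \<in> ideal_generated A)"
  unfolding ideal_generated_def by (simp add: module.span_insert[OF module_germ])

lemma ideal_generated_empty: "ideal_generated {} = {0}"
  by (simp add: ideal_generated_def module.span_empty[OF module_germ])

lemma ideal_generated_pair_iff: "h \<in> ideal_generated {f, g} \<longleftrightarrow> (\<exists>a b. h = a * f + b * g)"
  and ideal_generated_singleton_iff: "h \<in> ideal_generated {f} \<longleftrightarrow> f dvd h"
  by (auto simp: ideal_generated_insert_iff ideal_generated_empty
      algebra_simps dvd_def)

text \<open>With d the order of f on x = 0, the powers of y below d span modulo (f, x). Multiplying
  them by x^i for i < n and climbing through the powers of x gives at most n d generators.\<close>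

lemma finite_span_regular:
  assumes f: "\<not> germ_x dvd f"
  shows "\<exists>B. finite B \<and> spans_modulo B (ideal_generated {f, germ_x ^ n})"
proof -
  obtain d u where u: "u dvd 1" "germ_x dvd f - germ_y ^ d * u" by (rule germ_decompose[OF f])
  obtain w where w: "u * w = 1" using u(1) by (metis dvdE)
  obtain k where "f - germ_y ^ d * u = germ_x * k" using u(2) by (auto elim: dvdE)
  then have k: "f = germ_y ^ d * u + germ_x * k" by (simp add: diff_eq_eq add.commute)
  have poly: "\<exists>b s t. b \<in> germ_vec.span ((^) germ_y ` {..<m}) \<and> h = b + germ_y ^ m * s + germ_x * t" for m h
  proof (induction m)
    case 0
    show ?case by (intro exI[of _ 0] exI[of _ h] conjI germ_vec.span_zero) simp
  next
    case (Suc m)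
    then obtain b s t where b: "b \<in> germ_vec.span ((^) germ_y ` {..<m})"
      "h = b + germ_y ^ m * s + germ_x * t" by blast
    obtain c s' k where s: "s = germ_const c + germ_y * s' + germ_x * k" by (rule germ_split)
    have "b \<in> germ_vec.span ((^) germ_y ` {..<Suc m})"
      by (rule germ_vec.span_mono[THEN subsetD, OF image_mono b(1)]) auto
    then have "b + germ_scale c (germ_y ^ m) \<in> germ_vec.span ((^) germ_y ` {..<Suc m})"
      by (rule germ_vec.span_add[OF _ germ_vec.span_scale[OF germ_vec.span_base]]) auto
    moreover have "h = (b + germ_scale c (germ_y ^ m)) + germ_y ^ Suc m * s' + germ_x * (germ_y ^ m * k + t)"
      unfolding b(2) s by (simp add: germ_scale_def algebra_simps)
    ultimately show ?case by blast
  qed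
  define B where "B = (^) germ_y ` {..<d}"
  have base: "\<exists>b q r. b \<in> germ_vec.span B \<and> h = b + q * f + germ_x * r" for h
  proof -
    obtain b s t where b: "b \<in> germ_vec.span B" "h = b + germ_y ^ d * s + germ_x * t"
      using poly[where m = d] unfolding B_def by blast
    \<comment> \<open>Since u is a unit, y^d is a multiple of f modulo x: y^d = w f - x k w.\<close>
    have "germ_y ^ d * s = (u * w) * (germ_y ^ d * s)" by (simp add: w)
    also have "\<dots> = (w * s) * f - germ_x * (k * w * s)"
      unfolding k by (simp add: algebra_simps)
    finally have eq: "germ_y ^ d * s = (w * s) * f - germ_x * (k * w * s)" .
    have "h = b + (w * s) * f + germ_x * (t - k * w * s)"
      unfolding b(2) eq by (simp add: algebra_simps)
    then show ?thesis using b(1) by blast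
  qed
  show ?thesis
  proof (induction n)
    case 0
    have "h - 0 \<in> ideal_generated {f, germ_x ^ 0}" for h
      unfolding ideal_generated_pair_iff by (intro exI[of _ 0] exI[of _ h]) simp
    then show ?case unfolding spans_modulo_def using germ_vec.span_zero by (intro exI[of _ "{}"]) blast
  next
    case (Suc n)
    then obtain C where C: "finite C" "spans_modulo C (ideal_generated {f, germ_x ^ n})" by blast
    define C' where "C' = C \<union> (*) (germ_x ^ n) ` B"
    have "\<exists>b\<in>germ_vec.span C'. h - b \<in> ideal_generated {f, germ_x ^ Suc n}" for h
    proof -
      obtain c a r where c: "c \<in> germ_vec.span C" "h - c = a * f + r * germ_x ^ n"
        using C(2) unfolding spans_modulo_def ideal_generated_pair_iff by blast
      obtain b q s where b: "b \<in> germ_vec.span B" "r = b + q * f + germ_x * s" using base by blast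
      have "germ_x ^ n * b \<in> germ_vec.span C'"
        using span_mult_image[OF b(1), of "germ_x ^ n"] germ_vec.span_mono[of _ C'] by (auto simp: C'_def)
      moreover have "c \<in> germ_vec.span C'"
        using c(1) germ_vec.span_mono[of _ C'] by (auto simp: C'_def)
      ultimately have "c + germ_x ^ n * b \<in> germ_vec.span C'" by (rule germ_vec.span_add[rotated])
      moreover have "h - (c + germ_x ^ n * b) = (a + germ_x ^ n * q) * f + s * germ_x ^ Suc n"
        using c(2) b(2) by (simp add: algebra_simps)
      ultimately show ?thesis unfolding ideal_generated_pair_iff by blast
    qed
    moreover have "finite C'" using C(1) by (simp add: C'_def B_def)
    ultimately show ?case unfolding spans_modulo_def by blast
  qed
qed

text \<open>A power of x lies in (f, g), so a spanning set modulo the smaller ideal (f, x^n) still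
  works.\<close>

lemma finite_span_coprime_regular:
  assumes "coprime f g" and f: "\<not> germ_x dvd f"
  shows "\<exists>B. finite B \<and> spans_modulo B (ideal_generated {f, g})"
proof -
  obtain n a b where n: "germ_x ^ n = a * f + b * g"
    by (rule coprime_germ_x_power_regular[OF assms])
  have "ideal_generated {f, germ_x ^ n} \<subseteq> ideal_generated {f, g}"
  proof
    fix h assume "h \<in> ideal_generated {f, germ_x ^ n}"
    then obtain p q where h: "h = p * f + q * germ_x ^ n"
      unfolding ideal_generated_pair_iff by blast
    have "h = (p + q * a) * f + (q * b) * g" unfolding h n by (simp add: algebra_simps)
    then show "h \<in> ideal_generated {f, g}" unfolding ideal_generated_pair_iff by blast
  qed
  then show ?thesis using finite_span_regular[OF f, of n] spans_modulo_mono by blast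
qed

section \<open>Shears and arithmetic of germs\<close>

lemma cdiff2_at_shear:
  assumes "cdiff2_at f (fst z + c * snd z, snd z)"
  shows "cdiff2_at (\<lambda>z. f (fst z + c * snd z, snd z)) z"
proof -
  obtain a b where f: "(f has_derivative (\<lambda>h. a * fst h + b * snd h)) (at (fst z + c * snd z, snd z))"
    using assms unfolding cdiff2_at_def by blast
  have g: "((\<lambda>z. (fst z + c * snd z, snd z)) has_derivative (\<lambda>h. (fst h + c * snd h, snd h))) (at z)"
    by (auto intro!: derivative_eq_intros)
  have "((\<lambda>z. f (fst z + c * snd z, snd z)) has_derivative (\<lambda>h. a * fst h + (a * c + b) * snd h)) (at z)"
    by (rule has_derivative_eq_rhs[OF has_derivative_compose[OF g f]]) (auto simp: algebra_simps)
  then show ?thesis unfolding cdiff2_at_def by blast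
qed

lemma eventually_shear:
  assumes "\<forall>\<^sub>F z in nhds (0 :: complex \<times> complex). P z"
  shows "\<forall>\<^sub>F z in nhds 0. P (fst z + c * snd z, snd z)"
proof -
  have "isCont (\<lambda>z :: complex \<times> complex. (fst z + c * snd z, snd z)) 0"
    by (intro continuous_intros)
  then have "((\<lambda>z :: complex \<times> complex. (fst z + c * snd z, snd z)) \<longlongrightarrow> 0) (nhds 0)"
    using tendsto_at_iff_tendsto_nhds[of "\<lambda>z :: complex \<times> complex. (fst z + c * snd z, snd z)" 0]
    by (simp add: isCont_def zero_prod_def)
  then show ?thesis using assms by (rule eventually_compose_filterlim[rotated])
qed

lemma holomorphic_near_0_shear:
  "holomorphic_near_0 f \<Longrightarrow> holomorphic_near_0 (\<lambda>z. f (fst z + c * snd z, snd z))"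
  unfolding holomorphic_near_0_def
  by (drule eventually_shear[of _ c]) (auto elim!: eventually_mono intro: cdiff2_at_shear)

text \<open>On x = 0 the sheared germ is f restricted to the line x = c y, so choosing c means
  choosing a line on which f does not vanish.\<close>

lift_definition germ_shear :: "complex \<Rightarrow> germ \<Rightarrow> germ" is "\<lambda>c f z. f (fst z + c * snd z, snd z)"
  by (auto simp: germ_eq_def intro: holomorphic_near_0_shear eventually_shear)

lemma germ_shear_simps [simp]:
  "germ_shear c (a * b) = germ_shear c a * germ_shear c b"
  "germ_shear c (a + b) = germ_shear c a + germ_shear c b"
  "germ_shear c (a - b) = germ_shear c a - germ_shear c b"
  "germ_shear c 0 = 0" "germ_shear c 1 = 1" "germ_shear c (germ_const k) = germ_const k"
  by (transfer, auto simp: germ_eq_def holomorphic_near_0_const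
      intro!: holomorphic_near_0_shear holomorphic_near_0_add holomorphic_near_0_mult holomorphic_near_0_diff)+

lemma germ_shear_inverse [simp]: "germ_shear c (germ_shear (- c) a) = a"
  by transfer (simp add: germ_eq_def algebra_simps)

lemma germ_shear_inverse' [simp]: "germ_shear (- c) (germ_shear c a) = a"
  using germ_shear_inverse[of "- c"] by simp

lemma germ_shear_dvd_iff [simp]: "germ_shear c a dvd germ_shear c b \<longleftrightarrow> a dvd b"
proof
  assume "germ_shear c a dvd germ_shear c b"
  then obtain k where "germ_shear c b = germ_shear c a * k" by (auto elim: dvdE)
  from arg_cong[OF this, of "germ_shear (- c)"] show "a dvd b" by simp
qed (auto elim!: dvdE)

lemma coprime_germ_shear [simp]: "coprime (germ_shear c a) (germ_shear c b) \<longleftrightarrow> coprime a b"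
proof -
  have eq: "germ_shear c x dvd 1 \<longleftrightarrow> x dvd 1" for x
    using germ_shear_dvd_iff[of c x 1] by simp
  show ?thesis
  proof
    assume cop: "coprime (germ_shear c a) (germ_shear c b)"
    show "coprime a b"
      by (rule coprimeI) (use coprime_common_divisor[OF cop, of "germ_shear c x" for x] eq in simp)
  next
    assume cop: "coprime a b"
    show "coprime (germ_shear c a) (germ_shear c b)"
    proof (rule coprimeI)
      fix x assume "x dvd germ_shear c a" "x dvd germ_shear c b"
      then have "germ_shear (- c) x dvd a" "germ_shear (- c) x dvd b"
        using germ_shear_dvd_iff[of c "germ_shear (- c) x"] by simp_all
      then have "germ_shear (- c) x dvd 1" by (rule coprime_common_divisor[OF cop])
      then show "x dvd 1" using eq[of "germ_shear (- c) x"] by simp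
    qed
  qed
qed

text \<open>Otherwise \<open>f\<close> would vanish on every line \<open>x = c y\<close>.\<close>

lemma germ_shear_regular:
  assumes "f \<noteq> 0"
  obtains c where "\<not> germ_x dvd germ_shear c f"
proof (rule ccontr)
  assume "\<not> thesis"
  then have all: "germ_x dvd germ_shear c f" for c using that by blast
  obtain F S where F: "0 < S" "sep_holo S F" "f = abs_germ F" by (rule germ_rep)
  have zero: "F (x, y) = 0" if x: "x \<in> ball 0 S" and y: "y \<in> ball 0 S" and y0: "y \<noteq> 0" for x y
  proof -
    \<comment> \<open>The line x = c y is the one through the given point; F vanishes on it near 0,
      and the identity theorem along t(x, y) carries this to t = 1.\<close>
    define c where "c = x / y"
    have "holomorphic_near_0 (\<lambda>z. F (fst z + c * snd z, snd z))"
      using F by (intro holomorphic_near_0_shear) (auto simp: holomorphic_near_0_iff_sep_holo)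
    then obtain T where T: "0 < T" "sep_holo T (\<lambda>z. F (fst z + c * snd z, snd z))"
      by (auto simp: holomorphic_near_0_iff_sep_holo)
    have "germ_shear c f = abs_germ (\<lambda>z. F (fst z + c * snd z, snd z))"
      unfolding F(3) by (rule germ_shear.abs_eq) (rule germ_eqI_sep_holo[OF F(1,2)])
    then obtain r where r: "r > 0" "\<forall>y\<in>ball 0 r. F (c * y, y) = 0"
      using all[of c] germ_x_dvd_iff[OF T] by auto
    \<comment> \<open>For |t| < S / M the point t(x, y) stays in the polydisc, and M < S admits t =
      1.\<close>
    define M where "M = max (norm x) (norm y)"
    have M: "0 < M" "M < S" "norm x \<le> M" "norm y \<le> M" using x y y0 by (auto simp: M_def less_max_iff_disj)
    define U where "U = ball (0::complex) (S / M)"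
    have tU: "norm (t * x) < S" "norm (t * y) < S" if "t \<in> U" for t
    proof -
      have "norm t * M < S" using that M by (simp add: U_def field_simps)
      moreover have "norm t * norm x \<le> norm t * M" "norm t * norm y \<le> norm t * M"
        using M by (auto intro: mult_left_mono)
      ultimately show "norm (t * x) < S" "norm (t * y) < S" by (simp_all add: norm_mult)
    qed
    have hol: "(\<lambda>t. F (0 + t * x, 0 + t * y)) holomorphic_on U"
      unfolding holomorphic_on_def
    proof
      fix t assume "t \<in> U"
      then have "cdiff2_at F (0 + t * x, 0 + t * y)" using tU[of t] osgood[OF F(2)] by simp
      then show "(\<lambda>t. F (0 + t * x, 0 + t * y)) field_differentiable at t within U"
        by (rule field_differentiable_at_within[OF cdiff2_at_affine])
    qed
    define V where "V = ball (0::complex) (min (r / M) (S / M))"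
    have "F (t * x, t * y) = 0" if t: "t \<in> V" for t
    proof -
      have "norm t * M < r" using t M by (simp add: V_def field_simps)
      moreover have "norm t * norm y \<le> norm t * M" using M by (auto intro: mult_left_mono)
      ultimately have "t * y \<in> ball 0 r" by (simp add: norm_mult)
      then have "F (c * (t * y), t * y) = 0" using r(2) by blast
      then show ?thesis using y0 by (simp add: c_def mult.commute)
    qed
    moreover have "V \<noteq> {}" "V \<subseteq> U" "1 \<in> U" "open V" "open U" "connected U"
      using M r(1) F(1) by (auto simp: U_def V_def min_def not_le divide_less_0_iff)
    ultimately have "F (0 + 1 * x, 0 + 1 * y) = 0"
      using analytic_continuation_open[of V U "\<lambda>t. F (0 + t * x, 0 + t * y)" "\<lambda>_. 0" 1] hol
      by simp
    then show ?thesis by simp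
  qed
  \<comment> \<open>No line x = c y reaches the points with y = 0 and x \<noteq> 0. Multiplying by y
    covers them, and the ring has no zero divisors.\<close>
  have s: "sep_holo S (\<lambda>z. snd z)" "sep_holo S (\<lambda>_. 0)"
    using sep_holo_snd_power[of S 1] sep_holo_snd_comp[of "\<lambda>_. 0" S] by simp_all
  have "abs_germ (\<lambda>z. F z * snd z) = abs_germ (\<lambda>_. 0)"
    using abs_germ_eq_iff[OF F(1) sep_holo_mult[OF F(2) s(1)] s(2)] zero F(1) by auto
  then have "f * germ_y = 0"
    using abs_germ_arith(1)[OF F(1,2) s(1)] by (simp add: F(3) germ_y_def zero_germ_def)
  moreover have "germ_y \<noteq> 0" using not_germ_x_dvd_germ_y_power[of 1] by auto
  ultimately show False using assms by simp
qed

text \<open>Euclid's lemma, obtained without unique factorization: a shear makes a nonzero f regular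
  and preserves both coprimality and divisibility.\<close>

theorem coprime_germ_dvd_mult_cancel:
  fixes f g h :: germ
  assumes cop: "coprime f g" and dvd: "f dvd g * h"
  shows "f dvd h"
proof (cases "f = 0")
  case True
  then show ?thesis using assms by auto
next
  case False
  then obtain c where "\<not> germ_x dvd germ_shear c f" by (rule germ_shear_regular)
  moreover have "coprime (germ_shear c f) (germ_shear c g)" using cop by simp
  moreover have "germ_shear c f dvd germ_shear c g * germ_shear c h"
    using dvd germ_shear_dvd_iff[of c f "g * h"] by simp
  ultimately have "germ_shear c f dvd germ_shear c h"
    using coprime_dvd_mult_cancel_regular by blast
  then show ?thesis by simp
qed

lemma finite_span_coprime_nonzero:
  assumes "coprime f g" "f \<noteq> 0"
  shows "\<exists>B. finite B \<and> spans_modulo B (ideal_generated {f, g})"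
proof -
  obtain c where "\<not> germ_x dvd germ_shear c f" by (rule germ_shear_regular[OF assms(2)])
  then obtain B where B: "finite B" "spans_modulo B (ideal_generated {germ_shear c f, germ_shear c g})"
    using finite_span_coprime_regular[of "germ_shear c f" "germ_shear c g"] assms(1) by auto
  have span: "germ_shear (- c) b \<in> germ_vec.span (germ_shear (- c) ` B)" if "b \<in> germ_vec.span B" for b
    using that
  proof (induction rule: germ_vec.span_induct_alt)
    case (step k x y)
    have "germ_shear (- c) (germ_scale k x + y) = germ_scale k (germ_shear (- c) x) + germ_shear (- c) y"
      by (simp add: germ_scale_def)
    moreover have "germ_scale k (germ_shear (- c) x) + germ_shear (- c) y
        \<in> germ_vec.span (germ_shear (- c) ` B)"
      by (rule germ_vec.span_add[OF germ_vec.span_scale[OF germ_vec.span_base]]) (use step in auto)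
    ultimately show ?case by simp
  qed (simp add: germ_vec.span_zero)
  have "\<exists>b\<in>germ_vec.span (germ_shear (- c) ` B). h - b \<in> ideal_generated {f, g}" for h
  proof -
    obtain b p q where b: "b \<in> germ_vec.span B" "germ_shear c h - b = p * germ_shear c f + q * germ_shear c g"
      using B(2) unfolding spans_modulo_def ideal_generated_pair_iff by blast
    have "h - germ_shear (- c) b = germ_shear (- c) p * f + germ_shear (- c) q * g"
      using arg_cong[OF b(2), of "germ_shear (- c)"] by simp
    then show ?thesis using span[OF b(1)] unfolding ideal_generated_pair_iff by blast
  qed
  then show ?thesis using B(1) unfolding spans_modulo_def by (intro exI[of _ "germ_shear (- c) ` B"]) auto
qed

theorem finite_span_coprime:
  assumes "coprime f g"
  shows "\<exists>B. finite B \<and> spans_modulo B (ideal_generated {f, g})"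
proof (cases "f = 0")
  case True
  then have "g \<noteq> 0" using assms by auto
  then show ?thesis
    using finite_span_coprime_nonzero[of g f] assms by (simp add: coprime_commute insert_commute)
qed (use finite_span_coprime_nonzero assms in blast)

text \<open>Induction on the order m of d on x = 0. If d = a b with non-units, orders add and b has
  positive order, so a has smaller order.\<close>

lemma exists_irreducible_factor_regular:
  assumes "germ_x dvd d - germ_y ^ m * u" "u dvd 1" "\<not> d dvd 1"
  shows "\<exists>p. irreducible p \<and> p dvd d"
  using assms
proof (induction m arbitrary: d u rule: less_induct)
  case (less m)
  have X: "\<not> germ_x dvd germ_y ^ n * w" if "w dvd 1" for n w
    using not_germ_x_dvd_germ_y_power that by (metis dvd_mult_unit_iff)
  have d: "\<not> germ_x dvd d"
    using X[OF less.prems(2)] less.prems(1) by (metis dvd_diff_right_iff)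
  show ?case
  proof (cases "irreducible d")
    case False
    then obtain a b where ab: "d = a * b" "\<not> a dvd 1" "\<not> b dvd 1"
      using d less.prems(3) by (auto simp: irreducible_def)
    have "\<not> germ_x dvd a" "\<not> germ_x dvd b" using d ab(1) by auto
    obtain i v where v: "v dvd 1" "germ_x dvd a - germ_y ^ i * v"
      by (rule germ_decompose[OF \<open>\<not> germ_x dvd a\<close>])
    obtain j w where w: "w dvd 1" "germ_x dvd b - germ_y ^ j * w"
      by (rule germ_decompose[OF \<open>\<not> germ_x dvd b\<close>])
    obtain k where "b - germ_y ^ j * w = germ_x * k" using w(2) by (auto elim: dvdE)
    then have "germ_value (b - germ_y ^ j * w) = 0" by simp
    then have "j \<noteq> 0" using ab(3) w(1) by (cases j) (auto simp: germ_unit_iff)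
    have "d - germ_y ^ (i + j) * (v * w) =
        (a - germ_y ^ i * v) * b + germ_y ^ i * v * (b - germ_y ^ j * w)"
      unfolding ab(1) by (simp add: algebra_simps power_add)
    then have "germ_x dvd d - germ_y ^ (i + j) * (v * w)" using v w by simp
    then have diff: "germ_x dvd germ_y ^ m * u - germ_y ^ (i + j) * (v * w)"
      using dvd_diff[OF _ less.prems(1)] by fastforce
    \<comment> \<open>Both y^m u and y^(i+j) v w agree with d modulo x. If i \<ge> m, then i + j > m
      and their difference is y^m times a unit, which x does not divide.\<close>
    have "i < m"
    proof (rule ccontr)
      assume "\<not> i < m"
      then obtain n where n: "i + j = m + Suc n"
        using \<open>j \<noteq> 0\<close> less_imp_Suc_add[of m "i + j"] by auto
      have "germ_y ^ m * u - germ_y ^ (i + j) * (v * w) = germ_y ^ m * (u - germ_y * (germ_y ^ n * v * w))"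
        unfolding n by (simp add: algebra_simps power_add)
      moreover have "u - germ_y * (germ_y ^ n * v * w) dvd 1"
        using less.prems(2) by (simp add: germ_unit_iff)
      ultimately show False using X diff by metis
    qed
    then show ?thesis using less.IH[OF _ v(2,1) ab(2)] ab(1) by (metis dvd_mult2)
  qed auto
qed

lemma exists_irreducible_germ_factor:
  fixes d :: germ
  assumes "d \<noteq> 0" "\<not> d dvd 1"
  shows "\<exists>p. irreducible p \<and> p dvd d"
proof -
  obtain c where c: "\<not> germ_x dvd germ_shear c d" by (rule germ_shear_regular[OF assms(1)])
  obtain m u where "u dvd 1" "germ_x dvd germ_shear c d - germ_y ^ m * u" by (rule germ_decompose[OF c])
  moreover have "\<not> germ_shear c d dvd 1" using assms(2) by (metis germ_shear_dvd_iff germ_shear_simps(5))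
  ultimately obtain p where p: "irreducible p" "p dvd germ_shear c d"
    using exists_irreducible_factor_regular by blast
  have "irreducible (germ_shear (- c) p)"
    unfolding irreducible_def
  proof (intro conjI allI impI)
    show "germ_shear (- c) p \<noteq> 0"
      using p(1) by (metis germ_shear_inverse germ_shear_simps(4) not_irreducible_zero)
    show "\<not> germ_shear (- c) p dvd 1"
      using p(1) by (metis germ_shear_dvd_iff germ_shear_simps(5) irreducible_def)
    fix a b assume "germ_shear (- c) p = a * b"
    then have "p = germ_shear c a * germ_shear c b" by (metis germ_shear_inverse germ_shear_simps(1))
    then have "germ_shear c a dvd 1 \<or> germ_shear c b dvd 1" using p(1) by (auto simp: irreducible_def)
    then show "a dvd 1 \<or> b dvd 1" by (metis germ_shear_dvd_iff germ_shear_simps(5))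
  qed
  moreover have "germ_shear (- c) p dvd d" using p(2) by (metis germ_shear_dvd_iff germ_shear_inverse)
  ultimately show ?thesis by blast
qed

text \<open>A common divisor of p and b is a unit or an associate of p, and the latter would make p
  divide b; hence Euclid's lemma applies.\<close>

lemma irreducible_germ_prime:
  fixes p :: germ
  assumes "irreducible p" "p dvd a * b"
  shows "p dvd a \<or> p dvd b"
proof (rule disjCI)
  assume nb: "\<not> p dvd b"
  have "coprime p b"
  proof (rule coprimeI)
    fix c assume c: "c dvd p" "c dvd b"
    then obtain e where e: "p = c * e" by (auto elim: dvdE)
    then have "c dvd 1 \<or> e dvd 1" using assms(1) by (auto simp: irreducible_def)
    then show "c dvd 1" using c(2) nb e by (auto simp: mult_unit_dvd_iff)
  qed
  then show "p dvd a" using assms(2) coprime_germ_dvd_mult_cancel by (metis mult.commute)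
qed

section \<open>Bases of quotients\<close>

definition quotient_basis_on :: "germ set \<Rightarrow> germ set \<Rightarrow> nat \<Rightarrow> (nat \<Rightarrow> germ) \<Rightarrow> bool" where
  "quotient_basis_on V U n b \<longleftrightarrow> (\<forall>i<n. b i \<in> V) \<and>
     (\<forall>g\<in>V. \<exists>c. g - (\<Sum>i<n. germ_scale (c i) (b i)) \<in> U) \<and>
     (\<forall>c. (\<Sum>i<n. germ_scale (c i) (b i)) \<in> U \<longrightarrow> (\<forall>i<n. c i = 0))"

lemma quotient_basis_on_UNIV: "quotient_basis_on UNIV = quotient_basis"
  by (simp add: quotient_basis_on_def quotient_basis_def fun_eq_iff)

text \<open>Each \<open>b j\<close> is congruent modulo \<open>U\<close> to some \<open>d j\<close>
  in the span of \<open>B\<close>, and a linear relation among the \<open>d j\<close> is one among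
  the \<open>b j\<close> modulo \<open>U\<close>.\<close>

lemma independent_modulo_card_le:
  assumes U: "germ_vec.subspace U" and B: "finite B" "spans_modulo B U"
    and b: "\<And>c. (\<Sum>i<m. germ_scale (c i) (b i)) \<in> U \<Longrightarrow> \<forall>i<m. c i = (0::complex)"
  shows "m \<le> card B"
proof -
  have "\<forall>j. \<exists>d. d \<in> germ_vec.span B \<and> b j - d \<in> U"
    using B(2) unfolding spans_modulo_def by blast
  then obtain d where "\<forall>j. d j \<in> germ_vec.span B \<and> b j - d j \<in> U"
    by (rule choice[THEN exE])
  then have d: "\<And>j. d j \<in> germ_vec.span B" "\<And>j. b j - d j \<in> U" by blast+
  have zero: "\<forall>j<m. a j = 0" if "(\<Sum>j<m. germ_scale (a j) (d j)) = 0" for a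
  proof -
    have "(\<Sum>j<m. germ_scale (a j) (b j - d j)) \<in> U"
      using d U by (intro germ_vec.subspace_sum germ_vec.subspace_scale) auto
    then show ?thesis
      by (intro b) (simp add: germ_vec.scale_right_diff_distrib sum_subtractf that)
  qed
  \<comment> \<open>Independence is a property of sets, so coincidences \<open>d i = d j\<close>
    have to be excluded first.\<close>
  have inj: "inj_on d {..<m}"
  proof (rule inj_onI, rule ccontr)
    fix i j assume ij: "i \<in> {..<m}" "j \<in> {..<m}" "d i = d j" "i \<noteq> j"
    define a where "a = (\<lambda>k. if k = i then 1 else if k = j then -1 else (0::complex))"
    have "(\<Sum>k<m. germ_scale (a k) (d k)) = (\<Sum>k\<in>{i, j}. germ_scale (a k) (d k))"
      using ij by (intro sum.mono_neutral_right) (auto simp: a_def)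
    also have "\<dots> = 0" using ij by (simp add: a_def)
    finally show False using zero[of a] ij by (auto simp: a_def)
  qed
  have "germ_vec.independent (d ` {..<m})"
  proof (rule germ_vec.independent_if_scalars_zero)
    fix a x assume s: "(\<Sum>x\<in>d ` {..<m}. germ_scale (a x) x) = 0" and x: "x \<in> d ` {..<m}"
    then have "(\<Sum>j<m. germ_scale (a (d j)) (d j)) = 0" by (simp add: sum.reindex[OF inj])
    then show "a x = 0" using zero[of "\<lambda>j. a (d j)"] x by auto
  qed auto
  then show ?thesis
    using germ_vec.independent_span_bound[OF B(1), of "d ` {..<m}"] d(1) card_image[OF inj] by auto
qed

text \<open>A longest family in \<open>V\<close> that is independent modulo \<open>U\<close> is a
  basis; \<open>B\<close> bounds its length although it need not lie in \<open>V\<close>.\<close>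

lemma quotient_basis_on_exists:
  assumes U: "germ_vec.subspace U" and B: "finite B" "spans_modulo B U"
  obtains n b where "quotient_basis_on V U n b"
proof -
  define Q where "Q = (\<lambda>m::nat. \<exists>b. (\<forall>i<m. b i \<in> V) \<and>
    (\<forall>c. (\<Sum>i<m. germ_scale (c i) (b i)) \<in> U \<longrightarrow> (\<forall>i<m. c i = 0)))"
  have bound: "m \<le> card B" if "Q m" for m
    using that independent_modulo_card_le[OF U B, where m = m] unfolding Q_def by blast
  define n where "n = (GREATEST m. Q m)"
  have "Q 0" by (simp add: Q_def)
  then have "Q n" unfolding n_def by (rule GreatestI_nat) (rule bound)
  then obtain b where b: "\<forall>i<n. b i \<in> V"
    "\<And>c. (\<Sum>i<n. germ_scale (c i) (b i)) \<in> U \<Longrightarrow> \<forall>i<n. c i = 0"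
    unfolding Q_def by blast
  have "\<not> Q (Suc n)"
    using Greatest_le_nat[of Q "Suc n" "card B"] bound unfolding n_def[symmetric] by auto
  have "\<exists>c. g - (\<Sum>i<n. germ_scale (c i) (b i)) \<in> U" if g: "g \<in> V" for g
  proof -
    \<comment> \<open>Appending g breaks independence; independence of \<open>b\<close> forces a
      nonzero coefficient at g, so the relation can be solved for g.\<close>
    define b' where "b' = b(n := g)"
    have "\<forall>i<Suc n. b' i \<in> V" using b(1) g by (auto simp: b'_def less_Suc_eq)
    then obtain c where c: "(\<Sum>i<Suc n. germ_scale (c i) (b' i)) \<in> U" "\<not> (\<forall>i<Suc n. c i = 0)"
      using \<open>\<not> Q (Suc n)\<close> unfolding Q_def by blast
    define s where "s = (\<Sum>i<n. germ_scale (c i) (b i))"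
    have s: "s + germ_scale (c n) g \<in> U" using c(1) by (simp add: s_def b'_def)
    have cn: "c n \<noteq> 0"
    proof
      assume "c n = 0"
      then have "s \<in> U" using s by simp
      then show False using b(2)[of c] c(2) \<open>c n = 0\<close> by (auto simp: s_def less_Suc_eq)
    qed
    have "germ_scale (1 / c n) (s + germ_scale (c n) g) \<in> U"
      using U s by (rule germ_vec.subspace_scale)
    moreover have "germ_scale (1 / c n) s = - (\<Sum>i<n. germ_scale (- c i / c n) (b i))"
      by (simp add: s_def germ_vec.scale_sum_right germ_vec.scale_minus_left sum_negf)
    ultimately have "g - (\<Sum>i<n. germ_scale (- c i / c n) (b i)) \<in> U"
      using cn by (simp add: germ_vec.scale_right_distrib)
    then show ?thesis by (intro exI)
  qed
  then have "quotient_basis_on V U n b" using b unfolding quotient_basis_on_def by blast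
  then show thesis by (rule that)
qed

text \<open>Additivity of dimension in a chain: a combination in \<open>U\<close> lies in
  \<open>V\<close>, which kills the coefficients of \<open>b\<close> first, and then those of
  \<open>d\<close>.\<close>

lemma quotient_basis_on_trans:
  assumes V: "germ_vec.subspace V" and U: "U \<subseteq> V" and W: "V \<subseteq> W"
    and b: "quotient_basis_on W V m b" and d: "quotient_basis_on V U n d"
  shows "quotient_basis_on W U (m + n) (\<lambda>i. if i < m then b i else d (i - m))"
proof -
  let ?e = "\<lambda>i. if i < m then b i else d (i - m)"
  have split: "(\<Sum>i<m + k. germ_scale (c i) (?e i)) =
      (\<Sum>i<m. germ_scale (c i) (b i)) + (\<Sum>i<k. germ_scale (c (m + i)) (d i))" for c k
    by (induction k) simp_all
  have dV: "(\<Sum>i<n. germ_scale (c i) (d i)) \<in> V" for c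
    using d V by (intro germ_vec.subspace_sum germ_vec.subspace_scale) (auto simp: quotient_basis_on_def)
  show ?thesis
    unfolding quotient_basis_on_def split
  proof (intro conjI allI impI ballI)
    fix i assume "i < m + n"
    then show "?e i \<in> W" using b d W by (auto simp: quotient_basis_on_def)
  next
    fix g assume "g \<in> W"
    then obtain c where "g - (\<Sum>i<m. germ_scale (c i) (b i)) \<in> V"
      using b by (auto simp: quotient_basis_on_def)
    then obtain c' where "g - (\<Sum>i<m. germ_scale (c i) (b i)) - (\<Sum>i<n. germ_scale (c' i) (d i)) \<in> U"
      using d by (auto simp: quotient_basis_on_def)
    then show "\<exists>c. g - ((\<Sum>i<m. germ_scale (c i) (b i)) + (\<Sum>i<n. germ_scale (c (m + i)) (d i))) \<in> U"
      by (intro exI[of _ "\<lambda>i. if i < m then c i else c' (i - m)"]) (simp add: diff_diff_eq)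
  next
    fix c i assume c: "(\<Sum>i<m. germ_scale (c i) (b i)) + (\<Sum>i<n. germ_scale (c (m + i)) (d i)) \<in> U"
      and i: "i < m + n"
    from c U have "(\<Sum>i<m. germ_scale (c i) (b i)) + (\<Sum>i<n. germ_scale (c (m + i)) (d i)) \<in> V"
      by (rule rev_subsetD)
    then have "(\<Sum>i<m. germ_scale (c i) (b i)) \<in> V"
      using germ_vec.subspace_diff[OF V _ dV, of _ "\<lambda>i. c (m + i)"] by fastforce
    then have cm: "\<forall>i<m. c i = 0" using b by (auto simp: quotient_basis_on_def)
    then have "(\<Sum>i<n. germ_scale (c (m + i)) (d i)) \<in> U" using c by simp
    then have "\<forall>i<n. c (m + i) = 0"
      using d unfolding quotient_basis_on_def by (elim conjE allE[of _ "\<lambda>i. c (m + i)"]) simp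
    then show "c i = 0"
      using cm i by (cases "i < m") (auto dest!: spec[of _ "i - m"])
  qed
qed

lemma quotient_dim_add:
  assumes "germ_vec.subspace V" "germ_vec.subspace U" "U \<subseteq> V"
    and "quotient_basis V m b" "quotient_basis_on V U n d"
  shows "quotient_dim U = enat (m + n)"
  using quotient_basis_on_trans[OF assms(1,3) subset_UNIV _ assms(5)] assms(2,4)
    quotient_dim_eq[of U "m + n"] by (auto simp: quotient_basis_on_UNIV)

section \<open>Foliations\<close>

lemma germ_dx_mult: "germ_dx (f * g) = germ_dx f * g + f * germ_dx g"
proof transfer
  fix f g assume "germ_eq f f" "germ_eq g g"
  then have h: "holomorphic_near_0 f" "holomorphic_near_0 g" by (auto simp: germ_eq_def)
  have "partial_x (\<lambda>z. f z * g z) z = partial_x f z * g z + f z * partial_x g z"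
    if "cdiff2_at f z" "cdiff2_at g z" for z
    using that cdiff2_at_fst[of f "fst z" "snd z"] cdiff2_at_fst[of g "fst z" "snd z"]
    by (simp add: partial_x_def split_beta)
  then have "\<forall>\<^sub>F z in nhds 0. partial_x (\<lambda>z. f z * g z) z = partial_x f z * g z + f z * partial_x g z"
    using h unfolding holomorphic_near_0_def by (auto elim: eventually_elim2)
  then show "germ_eq (partial_x (\<lambda>z. f z * g z)) (\<lambda>z. partial_x f z * g z + f z * partial_x g z)"
    using h by (simp add: germ_eq_def holomorphic_near_0_partial_x holomorphic_near_0_add
        holomorphic_near_0_mult)
qed

lemma germ_dy_mult: "germ_dy (f * g) = germ_dy f * g + f * germ_dy g"
proof transfer
  fix f g assume "germ_eq f f" "germ_eq g g"
  then have h: "holomorphic_near_0 f" "holomorphic_near_0 g" by (auto simp: germ_eq_def)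
  have "partial_y (\<lambda>z. f z * g z) z = partial_y f z * g z + f z * partial_y g z"
    if "cdiff2_at f z" "cdiff2_at g z" for z
    using that cdiff2_at_snd[of f "fst z" "snd z"] cdiff2_at_snd[of g "fst z" "snd z"]
    by (simp add: partial_y_def split_beta)
  then have "\<forall>\<^sub>F z in nhds 0. partial_y (\<lambda>z. f z * g z) z = partial_y f z * g z + f z * partial_y g z"
    using h unfolding holomorphic_near_0_def by (auto elim: eventually_elim2)
  then show "germ_eq (partial_y (\<lambda>z. f z * g z)) (\<lambda>z. partial_y f z * g z + f z * partial_y g z)"
    using h by (simp add: germ_eq_def holomorphic_near_0_partial_y holomorphic_near_0_add
        holomorphic_near_0_mult)
qed

text \<open>For an irreducible common factor p and \<phi> = p g, the Leibniz rule leaves p dividing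
  v(p) g, where v(p) is the coefficient of \<omega> \<and> dp. Non-invariance and primality give p
  dvd g, so p^2 divides \<phi>, against reducedness.\<close>

lemma coprime_tangency:
  assumes "reduced_equation \<phi>" "no_invariant_component \<omega> \<phi>"
  shows "coprime \<phi> (apply_field (dual_field \<omega>) \<phi>)"
proof (rule coprimeI, rule ccontr)
  fix c assume c: "c dvd \<phi>" "c dvd apply_field (dual_field \<omega>) \<phi>" "\<not> c dvd 1"
  have "c \<noteq> 0" using c(1) assms(1) by (auto simp: reduced_equation_def)
  then obtain p where p: "irreducible p" "p dvd c" using exists_irreducible_germ_factor c(3) by blast
  obtain g where g: "\<phi> = p * g" using p(2) c(1) by (metis dvd_trans dvdE)
  have "apply_field (dual_field \<omega>) \<phi> =
      wedge \<omega> (differential p) * g + p * wedge \<omega> (differential g)"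
    by (simp add: apply_field_def dual_field_def wedge_def differential_def g germ_dx_mult germ_dy_mult
        algebra_simps)
  moreover have "p dvd apply_field (dual_field \<omega>) \<phi>" using p(2) c(2) by (rule dvd_trans)
  ultimately have "p dvd wedge \<omega> (differential p) * g" by (simp add: dvd_add_left_iff)
  moreover have "\<not> p dvd wedge \<omega> (differential p)"
    using assms(2) p(1) g unfolding no_invariant_component_def invariant_curve_def by auto
  ultimately have "p dvd g" using irreducible_germ_prime[OF p(1)] by blast
  then have "p\<^sup>2 dvd \<phi>" unfolding g power2_eq_square by simp
  then show False
    using assms(1) p(1) by (auto simp: reduced_equation_def squarefree_def irreducible_def)
qed

text \<open>Middle exactness of the Koszul complex of a coprime pair: \<omega> kills only the
  multiples of v = (-B, A).\<close>

lemma coprime_germ_syzygy: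
  fixes A B x y :: germ
  assumes cop: "coprime A B" and eq: "A * x + B * y = 0"
  obtains h where "x = - B * h" "y = A * h"
proof (cases "A = 0")
  case True
  then have "B dvd 1" using cop by simp
  then obtain B' where B': "B * B' = 1" by (metis dvdE)
  have y: "y = 0" using eq True B' by auto
  have "x = - B * (- B' * x)" using B' by (simp add: mult.assoc[symmetric])
  then show thesis by (rule that) (simp add: y True)
next
  case False
  have "B * y = A * - x" using eq by (simp add: eq_neg_iff_add_eq_0 add.commute)
  then have "A dvd y" using coprime_germ_dvd_mult_cancel[OF cop] by (metis dvd_triv_left)
  then obtain h where h: "y = A * h" by (auto elim: dvdE)
  have "A * (x + B * h) = 0" using eq h by (simp add: algebra_simps)
  then have "x = - B * h" using False by (simp add: eq_neg_iff_add_eq_0)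
  then show thesis using h that by blast
qed

text \<open>Both quotients are isomorphic to \<open>\<O>\<^sub>2\<^sup>2 / (\<Theta>\<^sub>X + \<O>\<^sub>2 v)\<close>, the first one by \<open>\<omega>\<close>, whose kernel on \<open>\<O>\<^sub>2\<^sup>2\<close> is
  \<open>\<O>\<^sub>2 v\<close> by coprimality, the second one by \<open>d\<phi>\<close>.\<close>

lemma quotient_basis_on_transfer:
  assumes cop: "coprime (fst \<omega>) (snd \<omega>)"
    and k: "quotient_basis_on (ideal_generated {\<phi>, germ_dx \<phi>, germ_dy \<phi>})
      (ideal_generated {\<phi>, apply_field (dual_field \<omega>) \<phi>}) n k"
  shows "\<exists>m. quotient_basis_on (ideal_generated {fst \<omega>, snd \<omega>}) (pairing \<omega> ` log_fields \<phi>) n m"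
proof -
  obtain A B where AB: "\<omega> = (A, B)" by (cases \<omega>)
  define a b where "a = germ_dx \<phi>" and "b = germ_dy \<phi>"
  have K: "h \<in> ideal_generated {\<phi>, a, b} \<longleftrightarrow> (\<exists>r p q. h = r * \<phi> + p * a + q * b)" for h
    by (auto simp: ideal_generated_insert_iff[of _ \<phi>] ideal_generated_pair_iff algebra_simps)
  have T: "apply_field (dual_field \<omega>) \<phi> = A * b - B * a"
    by (simp add: apply_field_def dual_field_def AB a_def b_def)
  have log: "(x, y) \<in> log_fields \<phi> \<longleftrightarrow> \<phi> dvd a * x + b * y" for x y
    by (simp add: log_fields_def pairing_def differential_def ideal_generated_singleton_iff a_def b_def)
  note k = k[folded a_def b_def, unfolded T quotient_basis_on_def]
  have "\<forall>i<n. \<exists>r p q. k i = r * \<phi> + p * a + q * b" using k K by blast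
  then obtain r p q where rpq: "\<And>i. i < n \<Longrightarrow> k i = r i * \<phi> + p i * a + q i * b" by metis
  \<comment> \<open>Modulo \<phi>, \<open>k i\<close> is d\<phi> of the field
    \<open>(p i, q i)\<close>; \<open>m i\<close> is \<omega> of the same field.\<close>
  define m where "m = (\<lambda>i. A * p i + B * q i)"
  define L where "L c x = (\<Sum>i<n. germ_scale (c i) (x i))" for c and x :: "nat \<Rightarrow> germ"
  have Lk: "L c k = L c r * \<phi> + L c p * a + L c q * b" for c
    by (simp add: L_def rpq sum_distrib_left sum.distrib germ_scale_def algebra_simps)
  have Lm: "L c m = A * L c p + B * L c q" for c
    by (simp add: L_def m_def sum_distrib_left sum.distrib germ_scale_def algebra_simps)
  have "quotient_basis_on (ideal_generated {A, B}) (pairing \<omega> ` log_fields \<phi>) n m"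
    unfolding quotient_basis_on_def L_def[symmetric]
  proof (intro conjI allI impI ballI)
    fix i
    have "m i = p i * A + q i * B" by (simp add: m_def mult.commute)
    then show "m i \<in> ideal_generated {A, B}" unfolding ideal_generated_pair_iff by blast
  next
    fix g assume "g \<in> ideal_generated {A, B}"
    then obtain s t where g: "g = s * A + t * B" by (auto simp: ideal_generated_pair_iff)
    have "0 * \<phi> + s * a + t * b \<in> ideal_generated {\<phi>, a, b}" using K by blast
    then obtain c where "0 * \<phi> + s * a + t * b - L c k \<in> ideal_generated {\<phi>, A * b - B * a}"
      using k unfolding L_def by blast
    then obtain e h where eh: "s * a + t * b - L c k = e * \<phi> + h * (A * b - B * a)"
      by (auto simp: ideal_generated_pair_iff)
    \<comment> \<open>Subtracting h v does not change the value of \<omega> and removes the multiple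
      of v(\<phi>) from that of d\<phi>, so the field becomes logarithmic.\<close>
    define x y where "x = s - L c p + h * B" and "y = t - L c q - h * A"
    have "a * x + b * y = (e + L c r) * \<phi>"
      using eh unfolding Lk x_def y_def by (simp add: algebra_simps)
    then have "(x, y) \<in> log_fields \<phi>" by (simp add: log)
    moreover have "g - L c m = pairing \<omega> (x, y)"
      by (simp add: g Lm pairing_def AB x_def y_def algebra_simps)
    ultimately show "\<exists>c. g - L c m \<in> pairing \<omega> ` log_fields \<phi>" by blast
  next
    fix c i assume "L c m \<in> pairing \<omega> ` log_fields \<phi>" and i: "i < n"
    then obtain x y where xy: "L c m = pairing \<omega> (x, y)" "(x, y) \<in> log_fields \<phi>" by auto
    \<comment> \<open>\<omega> kills \<open>(L c p, L c q) - (x, y)\<close>, so this field is h v,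
      and d\<phi> sends it to h v(\<phi>).\<close>
    have "A * (L c p - x) + B * (L c q - y) = 0"
      using xy(1) by (simp add: Lm pairing_def AB algebra_simps)
    then obtain h where h: "L c p - x = - B * h" "L c q - y = A * h"
      using coprime_germ_syzygy cop AB by (metis fst_conv snd_conv)
    obtain e where e: "a * x + b * y = \<phi> * e" using xy(2) unfolding log by (auto elim: dvdE)
    have pq: "L c p = x - B * h" "L c q = y + A * h" using h by (simp_all add: algebra_simps)
    have "L c k = L c r * \<phi> + (a * x + b * y) + h * (A * b - B * a)"
      unfolding Lk pq by (simp add: algebra_simps)
    also have "\<dots> = (L c r + e) * \<phi> + h * (A * b - B * a)"
      unfolding e by (simp add: algebra_simps)
    finally have "L c k \<in> ideal_generated {\<phi>, A * b - B * a}"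
      unfolding ideal_generated_pair_iff by blast
    then show "c i = 0" using k i unfolding L_def by blast
  qed
  then show ?thesis unfolding AB by auto
qed

text \<open>Finiteness is asserted together with the formula because \<open>the_enat\<close> says
  nothing at infinity; integers avoid truncated subtraction.\<close>

theorem corollary6p1:
  fixes \<omega> :: one_form and \<phi> :: germ
  assumes "foliation \<omega>" and "singular \<omega>"
    and "reduced_equation \<phi>"
    and "no_invariant_component \<omega> \<phi>"
  shows "mu_BR \<omega> \<phi> \<noteq> \<infinity> \<and> milnor_number \<omega> \<noteq> \<infinity> \<and>
    tangency_order \<omega> \<phi> \<noteq> \<infinity> \<and> tjurina_number \<phi> \<noteq> \<infinity> \<and>
    int (the_enat (mu_BR \<omega> \<phi>)) =
      int (the_enat (milnor_number \<omega>)) + int (the_enat (tangency_order \<omega> \<phi>))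
        - int (the_enat (tjurina_number \<phi>))"
proof -
  define M where "M = ideal_generated {fst \<omega>, snd \<omega>}"
  define J where "J = pairing \<omega> ` log_fields \<phi>"
  define T where "T = ideal_generated {\<phi>, apply_field (dual_field \<omega>) \<phi>}"
  define K where "K = ideal_generated {\<phi>, germ_dx \<phi>, germ_dy \<phi>}"
  have cop: "coprime (fst \<omega>) (snd \<omega>)" using assms(1) by (simp add: foliation_def)
  have sub: "germ_vec.subspace M" "germ_vec.subspace J" "germ_vec.subspace T" "germ_vec.subspace K"
    by (simp_all add: M_def J_def T_def K_def subspace_ideal_generated subspace_pairing_log_fields)
  have TK: "T \<subseteq> K"
  proof
    fix h assume "h \<in> T"
    then obtain r s where "h = r * \<phi> + s * apply_field (dual_field \<omega>) \<phi>"
      by (auto simp: T_def ideal_generated_pair_iff)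
    then have "h - r * \<phi> = (- s * snd \<omega>) * germ_dx \<phi> + (s * fst \<omega>) * germ_dy \<phi>"
      by (simp add: apply_field_def dual_field_def algebra_simps)
    then show "h \<in> K"
      unfolding K_def ideal_generated_insert_iff[of _ \<phi>] ideal_generated_pair_iff by blast
  qed
  have JM: "J \<subseteq> M"
    unfolding J_def M_def pairing_def ideal_generated_pair_iff subset_iff image_iff
    by (metis mult.commute)
  obtain BM where BM: "finite BM" "spans_modulo BM M"
    using finite_span_coprime[OF cop] unfolding M_def by blast
  obtain m bM where M: "quotient_basis M m bM"
    by (rule quotient_basis_on_exists[OF sub(1) BM, of UNIV]) (simp add: quotient_basis_on_UNIV)
  obtain BT where BT: "finite BT" "spans_modulo BT T"
    using finite_span_coprime[OF coprime_tangency[OF assms(3,4)]] unfolding T_def by blast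
  \<comment> \<open>The Tjurina ideal contains \<open>T\<close>, so the same finite set spans modulo
    it.\<close>
  obtain t bK where K: "quotient_basis K t bK"
    by (rule quotient_basis_on_exists[OF sub(4) BT(1) spans_modulo_mono[OF BT(2) TK], of UNIV])
      (simp add: quotient_basis_on_UNIV)
  \<comment> \<open>The one number n serves both quotients: the tangency order becomes t + n and
    \<open>mu_BR\<close> becomes m + n.\<close>
  obtain n k where k: "quotient_basis_on K T n k" by (rule quotient_basis_on_exists[OF sub(3) BT])
  obtain j where j: "quotient_basis_on M J n j"
    using quotient_basis_on_transfer[OF cop] k unfolding M_def J_def T_def K_def by blast
  have "milnor_number \<omega> = enat m" "tjurina_number \<phi> = enat t"
    unfolding milnor_number_def tjurina_number_def M_def[symmetric] K_def[symmetric]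
    by (rule quotient_dim_eq[OF sub(1) M], rule quotient_dim_eq[OF sub(4) K])
  moreover have "tangency_order \<omega> \<phi> = enat (t + n)" "mu_BR \<omega> \<phi> = enat (m + n)"
    unfolding tangency_order_def mu_BR_def T_def[symmetric] J_def[symmetric]
    by (rule quotient_dim_add[OF sub(4,3) TK K k], rule quotient_dim_add[OF sub(1,2) JM M j])
  ultimately show ?thesis by simp
qed

end
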